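(* Let $r \geq 3$, $t \geq r-2$ and $k$ be integers. Then there is a finite collection $\mathcal{C}$ of graphs such that the following holds for every graph $G$ on $n$ vertices: $G$ is $K_r$-saturated with $\delta(G) \geq t$ and $e(G) = tn+k$ if and only if $G$ is obtained from a graph in $\mathcal{C}$ by blowing up (pairwise) non-adjacent vertices of degree $t$.
   Context: All graphs are finite and simple. A graph $G$ is $K_r$-saturated if it contains no copy of the complete graph $K_r$ but adding any new edge creates a copy of $K_r$. $\delta(G)$ is the minimum degree and $e(G)$ the number of edges. A blow-up of a graph $H$ is a graph obtained by replacing each vertex of $H$ by some positive number of copies, where two copies are adjacent if and only if the vertices of $H$ they are copies of are adjacent (in particular, copies of the same vertex are non-adjacent). Blowing up a set of vertices means replacing each vertex of that set by some positive number of copies and leaving all other vertices as single copies. *)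

theory Defs
  imports Main
begin

record 'a ugraph =
  verts :: "'a set"
  edges :: "'a set set"

text \<open>Finite simple graphs. The graph without vertices is excluded, so that the minimum degree
  is always defined.\<close>

definition simple_graph :: "'a ugraph \<Rightarrow> bool" where
  "simple_graph G \<longleftrightarrow> finite (verts G) \<and> verts G \<noteq> {} \<and>
     (\<forall>e\<in>edges G. e \<subseteq> verts G \<and> card e = 2)"

definition degree :: "'a ugraph \<Rightarrow> 'a \<Rightarrow> nat" where
  "degree G v = card {u \<in> verts G. {v, u} \<in> edges G}"

definition min_degree :: "'a ugraph \<Rightarrow> nat" where
  "min_degree G = Min (degree G ` verts G)"

definition contains_complete :: "nat \<Rightarrow> 'a ugraph \<Rightarrow> bool" where
  "contains_complete r G \<longleftrightarrow>
     (\<exists>K\<subseteq>verts G. card K = r \<and> (\<forall>u\<in>K. \<forall>v\<in>K. u \<noteq> v \<longrightarrow> {u, v} \<in> edges G))"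

definition add_edge :: "'a ugraph \<Rightarrow> 'a \<Rightarrow> 'a \<Rightarrow> 'a ugraph" where
  "add_edge G u v = G\<lparr>edges := insert {u, v} (edges G)\<rparr>"

definition complete_saturated :: "nat \<Rightarrow> 'a ugraph \<Rightarrow> bool" where
  "complete_saturated r G \<longleftrightarrow> \<not> contains_complete r G \<and>
     (\<forall>u\<in>verts G. \<forall>v\<in>verts G.
        u \<noteq> v \<and> {u, v} \<notin> edges G \<longrightarrow> contains_complete r (add_edge G u v))"

definition isomorphic :: "'a ugraph \<Rightarrow> 'b ugraph \<Rightarrow> bool" where
  "isomorphic G H \<longleftrightarrow> (\<exists>f. bij_betw f (verts G) (verts H) \<and>
     (\<forall>u\<in>verts G. \<forall>v\<in>verts G. {u, v} \<in> edges G \<longleftrightarrow> {f u, f v} \<in> edges H))"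

text \<open>The vertex \<open>v\<close> is replaced by the \<open>m v\<close> copies \<open>(v, 0), \<dots>, (v, m v - 1)\<close>.\<close>

definition blow_up :: "'a ugraph \<Rightarrow> ('a \<Rightarrow> nat) \<Rightarrow> ('a \<times> nat) ugraph" where
  "blow_up H m =
     \<lparr>verts = (SIGMA v:verts H. {..<m v}),
      edges = {{(u, i), (v, j)} | u i v j. {u, v} \<in> edges H \<and> i < m u \<and> j < m v}\<rparr>"

text \<open>\<open>G\<close> arises, up to isomorphism, from \<open>H\<close> by blowing up the vertices in \<open>S\<close>.\<close>

definition obtained_by_blowing_up :: "'a ugraph \<Rightarrow> 'b ugraph \<Rightarrow> 'b set \<Rightarrow> bool" where
  "obtained_by_blowing_up G H S \<longleftrightarrow>
     (\<exists>m. (\<forall>v\<in>S. m v \<ge> 1) \<and> (\<forall>v\<in>verts H - S. m v = 1) \<and> isomorphic G (blow_up H m))"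

definition pairwise_nonadjacent :: "'a ugraph \<Rightarrow> 'a set \<Rightarrow> bool" where
  "pairwise_nonadjacent H S \<longleftrightarrow> (\<forall>u\<in>S. \<forall>v\<in>S. {u, v} \<notin> edges H)"

end

theory Submission imports Defs
begin

text \<open>
  Let \<open>f(R) = e(R) - t |R|\<close> for a set \<open>R\<close> of vertices, and call a vertex low if its degree is at most
  \<open>2t\<close>. If the low vertices \<open>x\<close> have many distinct sets \<open>N(x) - R\<close>, then there is a large sunflower of
  neighbourhoods \<open>N(x\<^sub>i)\<close> with kernel \<open>K\<close> and vertices \<open>y\<^sub>i\<close> in the petals outside of \<open>R\<close>. As \<open>y\<^sub>i\<close>
  and \<open>x\<^sub>j\<close> have a common \<open>(r - 2)\<close>-clique, which together with \<open>x\<^sub>i\<close> and \<open>y\<^sub>i\<close> would be a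
  \<open>K\<^sub>r\<close> if it were contained in \<open>K\<close>, every \<open>y\<^sub>i\<close> has neighbours in all other petals. So adding \<open>p\<close>
  of these neighbourhoods to \<open>R\<close> yields about \<open>p\<^sup>2\<close> new edges but only \<open>O(p)\<close> new vertices, and \<open>f\<close> grows.

  For a maximiser \<open>R\<close> of \<open>f\<close> there are therefore boundedly many sets \<open>N(x) - R\<close>. Adding them to \<open>R\<close>
  costs a constant, and then the remaining vertices contribute at least \<open>t\<close> edges each, because the low
  ones have all their neighbours in \<open>R\<close> and the others have degree above \<open>2t\<close>. Hence \<open>f(V) \<ge> f(R) - c\<close>
  for all \<open>R\<close>. If \<open>f(V) = k\<close>, then \<open>R = {}\<close> cannot be improved by more than \<open>k + c\<close> either, so that
  there are boundedly many neighbourhoods of low vertices, and the same count bounds the number of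
  vertices of degree other than \<open>t\<close>. What remains are boundedly many classes of twins of degree \<open>t\<close>, and
  shrinking those with more than \<open>t + 1\<close> members to \<open>t + 1\<close> members gives a graph of bounded order.
\<close>

section \<open>Neighbourhoods, cliques and common cliques of non-adjacent vertices\<close>

definition nbhd :: "'a ugraph \<Rightarrow> 'a \<Rightarrow> 'a set" where
  "nbhd G v = {u \<in> verts G. {v, u} \<in> edges G}"

definition complete_on :: "'a ugraph \<Rightarrow> 'a set \<Rightarrow> bool" where
  "complete_on G K \<longleftrightarrow> K \<subseteq> verts G \<and> (\<forall>u\<in>K. \<forall>v\<in>K. u \<noteq> v \<longrightarrow> {u, v} \<in> edges G)"

definition adj_pairs :: "'a ugraph \<Rightarrow> 'a set \<Rightarrow> ('a \<times> 'a) set" where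
  "adj_pairs G S = {(u, v) \<in> S \<times> S. {u, v} \<in> edges G}"

text \<open>Edges are counted as ordered pairs, so this is twice the quantity \<open>f\<close> above.\<close>

definition surplus :: "nat \<Rightarrow> 'a ugraph \<Rightarrow> 'a set \<Rightarrow> int" where
  "surplus t G S = int (card (adj_pairs G S)) - 2 * int t * int (card S)"

lemma degree_nbhd: "degree G v = card (nbhd G v)"
  by (simp add: degree_def nbhd_def)

lemma contains_complete_iff:
  "contains_complete r G \<longleftrightarrow> (\<exists>K. complete_on G K \<and> card K = r)"
  unfolding contains_complete_def complete_on_def by blast

lemma simple_graph_finite: "simple_graph G \<Longrightarrow> finite (verts G)"
  by (simp add: simple_graph_def)

lemma simple_graph_irrefl: "simple_graph G \<Longrightarrow> {u, u} \<notin> edges G"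
  unfolding simple_graph_def by fastforce

lemma simple_graph_edge_verts:
  assumes "simple_graph G" "{u, v} \<in> edges G"
  shows "u \<in> verts G" "v \<in> verts G" "u \<noteq> v"
proof -
  have "{u, v} \<subseteq> verts G" using assms unfolding simple_graph_def by blast
  then show "u \<in> verts G" "v \<in> verts G" by auto
  show "u \<noteq> v" using assms simple_graph_irrefl[of G u] by auto
qed

lemma finite_edges: "simple_graph G \<Longrightarrow> finite (edges G)"
  unfolding simple_graph_def by (meson Pow_iff finite_Pow_iff finite_subset subsetI)

lemma in_nbhd_iff: "simple_graph G \<Longrightarrow> u \<in> nbhd G v \<longleftrightarrow> {v, u} \<in> edges G"
  unfolding nbhd_def using simple_graph_edge_verts by fastforce

lemma nbhd_sym: "simple_graph G \<Longrightarrow> u \<in> nbhd G v \<longleftrightarrow> v \<in> nbhd G u"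
  by (simp add: in_nbhd_iff insert_commute)

lemma nbhd_subset: "nbhd G v \<subseteq> verts G"
  by (auto simp: nbhd_def)

lemma finite_nbhd: "simple_graph G \<Longrightarrow> finite (nbhd G v)"
  using finite_subset nbhd_subset simple_graph_finite by metis

lemma min_degree_ge_iff:
  assumes "simple_graph G"
  shows "min_degree G \<ge> t \<longleftrightarrow> (\<forall>v\<in>verts G. degree G v \<ge> t)"
  using assms unfolding simple_graph_def min_degree_def by (subst Min_ge_iff) auto

lemma complete_onD: "complete_on G K \<Longrightarrow> u \<in> K \<Longrightarrow> v \<in> K \<Longrightarrow> u \<noteq> v \<Longrightarrow> {u, v} \<in> edges G"
  unfolding complete_on_def by blast

lemma complete_on_subset: "complete_on G K \<Longrightarrow> L \<subseteq> K \<Longrightarrow> complete_on G L"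
  unfolding complete_on_def by blast

lemma complete_on_insert:
  assumes "simple_graph G" "complete_on G K" "K \<subseteq> nbhd G v" "v \<in> verts G"
  shows "complete_on G (insert v K)"
  using assms unfolding complete_on_def
  by (auto simp: subset_iff in_nbhd_iff[OF assms(1)] insert_commute)

text \<open>The clique created by the new edge has to contain both its ends, since \<open>G\<close>
  itself has no \<open>r\<close>-clique. Deleting \<open>u\<close> and \<open>v\<close> from it
  leaves \<open>Q\<close>.\<close>

lemma complete_saturated_common_clique:
  assumes "simple_graph G" and sat: "complete_saturated r G"
    and uv: "u \<in> verts G" "v \<in> verts G" "u \<noteq> v" "{u, v} \<notin> edges G"
  obtains Q where "complete_on G Q" "card Q = r - 2" "Q \<subseteq> nbhd G u" "Q \<subseteq> nbhd G v"
proof -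
  have "contains_complete r (add_edge G u v)"
    using sat uv unfolding complete_saturated_def by blast
  then obtain K where K: "K \<subseteq> verts G" "card K = r"
    "\<And>a b. a \<in> K \<Longrightarrow> b \<in> K \<Longrightarrow> a \<noteq> b \<Longrightarrow> {a, b} \<in> insert {u, v} (edges G)"
    unfolding contains_complete_def add_edge_def by auto
  have "\<not> complete_on G K"
    using sat K(2) unfolding complete_saturated_def contains_complete_iff by blast
  then obtain a b where ab: "a \<in> K" "b \<in> K" "a \<noteq> b" "{a, b} \<notin> edges G"
    using K(1) unfolding complete_on_def by blast
  then have "{a, b} = {u, v}" using K(3)[OF ab(1-3)] by blast
  then have inK: "u \<in> K" "v \<in> K" using ab by (auto simp: doubleton_eq_iff)
  have edge: "{a, b} \<in> edges G" if "a \<in> K" "b \<in> K" "a \<noteq> b" "a \<noteq> u" "a \<noteq> v" for a b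
    using K(3)[OF that(1-3)] that by (auto simp: doubleton_eq_iff)
  have "{u, x} \<in> edges G" "{v, x} \<in> edges G" if "x \<in> K - {u, v}" for x
    using edge[of x u] edge[of x v] inK that by (auto simp: insert_commute)
  then have sub: "K - {u, v} \<subseteq> nbhd G u" "K - {u, v} \<subseteq> nbhd G v"
    unfolding subset_iff in_nbhd_iff[OF assms(1)] by blast+
  show ?thesis
  proof
    show "complete_on G (K - {u, v})" unfolding complete_on_def using edge K(1) by blast
    show "card (K - {u, v}) = r - 2"
      using inK K(2) uv(3) finite_subset[OF K(1) simple_graph_finite[OF assms(1)]]
      by (subst card_Diff_subset) auto
  qed (use sub in auto)
qed

text \<open>Here \<open>Q\<close> together with \<open>u\<close> and \<open>v\<close> is the clique
  that the new edge creates; \<open>r \<ge> 2\<close> makes the truncated difference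
  \<open>r - 2\<close> add up to \<open>r\<close> again.\<close>

lemma complete_saturatedI:
  assumes G: "simple_graph G" and "r \<ge> 2" and free: "\<not> contains_complete r G"
    and cl: "\<And>u v. \<lbrakk>u \<in> verts G; v \<in> verts G; u \<noteq> v; {u, v} \<notin> edges G\<rbrakk> \<Longrightarrow>
      \<exists>Q. complete_on G Q \<and> card Q = r - 2 \<and> Q \<subseteq> nbhd G u \<and> Q \<subseteq> nbhd G v"
  shows "complete_saturated r G"
  unfolding complete_saturated_def
proof (intro conjI ballI impI free)
  fix u v assume uv: "u \<in> verts G" "v \<in> verts G" "u \<noteq> v \<and> {u, v} \<notin> edges G"
  then obtain Q where Q: "complete_on G Q" "card Q = r - 2" "Q \<subseteq> nbhd G u" "Q \<subseteq> nbhd G v"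
    using cl by blast
  have "finite Q" using Q(3) finite_nbhd[OF G] finite_subset by blast
  moreover have "u \<notin> Q" "v \<notin> Q"
    using Q(3,4) simple_graph_irrefl[OF G] by (auto simp: in_nbhd_iff[OF G] subset_iff)
  ultimately have "card (insert u (insert v Q)) = r" using Q(2) uv \<open>r \<ge> 2\<close> by auto
  moreover have "insert u (insert v Q) \<subseteq> verts G"
    using uv Q(1) unfolding complete_on_def by auto
  moreover have "{a, b} \<in> insert {u, v} (edges G)"
    if "a \<in> insert u (insert v Q)" "b \<in> insert u (insert v Q)" "a \<noteq> b" for a b
    using that Q by (auto simp: in_nbhd_iff[OF G] subset_iff complete_on_def insert_commute)
  ultimately show "contains_complete r (add_edge G u v)"
    unfolding contains_complete_def add_edge_def
    by (intro exI[of _ "insert u (insert v Q)"]) auto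
qed

subsection \<open>Sunflowers\<close>

text \<open>In the recursion \<open>p * Suc k\<close> bounds the number of points covered by fewer
  than \<open>p\<close> sets of size at most \<open>Suc k\<close>. The summand 1 pays for the empty
  set, which contains none of these points.\<close>

fun sunflower_bound :: "nat \<Rightarrow> nat \<Rightarrow> nat" where
  "sunflower_bound p 0 = 1"
| "sunflower_bound p (Suc k) = 1 + p * Suc k * sunflower_bound p k"

text \<open>The Erdos-Rado sunflower lemma for sets of size at most \<open>k\<close>. A maximal
  disjoint subfamily either has \<open>p\<close> members, giving an empty kernel, or has a small
  union that every nonempty member meets. Then some point lies in many members; induction applies
  after deleting this point, which joins the kernel.\<close>

lemma sunflower:
  assumes "finite F" "\<And>A. A \<in> F \<Longrightarrow> finite A \<and> card A \<le> k" "card F > sunflower_bound p k"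
  shows "\<exists>S\<subseteq>F. \<exists>K. card S = p \<and> (\<forall>A\<in>S. \<forall>B\<in>S. A \<noteq> B \<longrightarrow> A \<inter> B = K)"
  using assms
proof (induction k arbitrary: F)
  case 0
  have "F \<subseteq> {{}}"
  proof
    fix A assume "A \<in> F"
    then show "A \<in> {{}}" using "0.prems"(2)[of A] by auto
  qed
  then have "card F \<le> 1" using card_mono[of "{{}}" F] by simp
  then show ?case using 0 by simp
next
  case (Suc k)
  let ?P = "\<lambda>S. S \<subseteq> F \<and> pairwise disjnt S"
  have "finite {S. ?P S}" using Suc.prems(1) by (auto intro: finite_subset[of _ "Pow F"])
  moreover have "?P {}" by simp
  then have "{S. ?P S} \<noteq> {}" by blast
  ultimately have "\<exists>S\<in>{S. ?P S}. \<forall>T\<in>{S. ?P S}. S \<subseteq> T \<longrightarrow> S = T"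
    by (rule finite_has_maximal)
  then obtain S where S: "?P S" and max: "\<forall>T. ?P T \<longrightarrow> S \<subseteq> T \<longrightarrow> S = T"
    by auto
  have finS: "finite S" using S Suc.prems(1) finite_subset by blast
  show ?case
  proof (cases "card S \<ge> p")
    case True
    then obtain T where "T \<subseteq> S" "card T = p" using obtain_subset_with_card_n by blast
    then have "T \<subseteq> F" "card T = p" "\<forall>A\<in>T. \<forall>B\<in>T. A \<noteq> B \<longrightarrow> A \<inter> B = {}"
      using S unfolding pairwise_def disjnt_def by blast+
    then show ?thesis by blast
  next
    case False
    let ?U = "\<Union>S"
    have finU: "finite ?U" using finS S Suc.prems(2) by auto
    have "card ?U \<le> (\<Sum>A\<in>S. card A)" by (rule card_Union_le_sum_card)
    also have "\<dots> \<le> (\<Sum>A\<in>S. Suc k)" using S Suc.prems(2) by (intro sum_mono) auto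
    also have "\<dots> \<le> p * Suc k" using False by (simp only: sum_constant) (intro mult_le_mono, auto)
    finally have cardU: "card ?U \<le> p * Suc k" .
    \<comment> \<open>By maximality a member disjoint from the union would belong to
      \<open>S\<close>, and so lie inside the union that it avoids.\<close>
    have meets: "A \<inter> ?U \<noteq> {}" if "A \<in> F" "A \<noteq> {}" for A
    proof
      assume e: "A \<inter> ?U = {}"
      then have "pairwise disjnt (insert A S)"
        using S by (auto simp: pairwise_insert disjnt_def)
      then have "S = insert A S" using max S that(1) by (meson insert_subset subset_insertI)
      then show False using e that by blast
    qed
    let ?F = "\<lambda>u. {A \<in> F. u \<in> A}"
    have "\<exists>u\<in>?U. card (?F u) > sunflower_bound p k"
    proof (rule ccontr)
      assume "\<not> ?thesis"
      then have le: "card (?F u) \<le> sunflower_bound p k" if "u \<in> ?U" for u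
        using that by (meson not_le)
      have "F \<subseteq> insert {} (\<Union>u\<in>?U. ?F u)" using meets by blast
      then have "card F \<le> card (insert {} (\<Union>u\<in>?U. ?F u))"
        using finU Suc.prems(1) by (intro card_mono finite.insertI finite_UN_I) auto
      also have "\<dots> \<le> 1 + card (\<Union>u\<in>?U. ?F u)" by (simp add: card_insert_le_m1)
      also have "card (\<Union>u\<in>?U. ?F u) \<le> (\<Sum>u\<in>?U. card (?F u))" by (rule card_UN_le[OF finU])
      also have "\<dots> \<le> (\<Sum>u\<in>?U. sunflower_bound p k)" using le by (rule sum_mono)
      also have "\<dots> \<le> p * Suc k * sunflower_bound p k" using cardU by (simp only: sum_constant) (intro mult_le_mono, auto)
      finally show False using Suc.prems(3) by simp
    qed
    then obtain u where u: "card (?F u) > sunflower_bound p k" by blast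
    let ?G = "(\<lambda>A. A - {u}) ` ?F u"
    have "inj_on (\<lambda>A. A - {u}) (?F u)" by (rule inj_onI) blast
    then have "card ?G > sunflower_bound p k" using u by (simp add: card_image)
    moreover have "finite ?G" using Suc.prems(1) by simp
    moreover have "finite A \<and> card A \<le> k" if "A \<in> ?G" for A
    proof -
      obtain B where B: "B \<in> F" "u \<in> B" "A = B - {u}" using \<open>A \<in> ?G\<close> by blast
      then show ?thesis using Suc.prems(2)[OF B(1)] by (auto simp: card_Diff_singleton)
    qed
    ultimately obtain T K where T: "T \<subseteq> ?G" "card T = p" "\<forall>A\<in>T. \<forall>B\<in>T. A \<noteq> B \<longrightarrow> A \<inter> B = K"
      using Suc.IH[of ?G] by blast
    have "inj_on (insert u) T" using T(1) by (intro inj_onI) blast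
    then have "card (insert u ` T) = p" using T(2) by (simp add: card_image)
    moreover have "insert u ` T \<subseteq> F"
    proof
      fix B assume "B \<in> insert u ` T"
      then obtain A where "A \<in> F" "u \<in> A" "B = insert u (A - {u})" using T(1) by blast
      then show "B \<in> F" by (simp add: insert_absorb)
    qed
    moreover have "\<forall>A\<in>insert u ` T. \<forall>B\<in>insert u ` T. A \<noteq> B \<longrightarrow> A \<inter> B = insert u K"
    proof (intro ballI impI)
      fix A B assume "A \<in> insert u ` T" "B \<in> insert u ` T" "A \<noteq> B"
      then obtain A' B' where "A' \<in> T" "B' \<in> T" "A' \<noteq> B'" "A = insert u A'" "B = insert u B'"
        by blast
      then show "A \<inter> B = insert u K" using T(3) by auto
    qed
    ultimately show ?thesis by blast
  qed
qed

subsection \<open>The surplus of vertex sets in saturated graphs\<close>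

lemma finite_adj_pairs: "finite S \<Longrightarrow> finite (adj_pairs G S)"
  unfolding adj_pairs_def by (rule finite_subset[of _ "S \<times> S"]) auto

text \<open>Each neighbourhood adds at most \<open>2 * t\<close> vertices, which costs at most
  \<open>4 * t * t\<close> in surplus. All but at most \<open>2 * p\<close> of the
  \<open>p * p\<close> ordered pairs from \<open>X\<close> yield a new adjacent pair of their own,
  leading from one petal to another.\<close>

lemma surplus_gain_of_sunflower:
  fixes G :: "'a ugraph"
  assumes G: "simple_graph G" and sat: "complete_saturated r G" and r: "r \<ge> 2"
    and R: "R \<subseteq> verts G" and X: "X \<subseteq> verts G"
    and low: "\<And>x. x \<in> X \<Longrightarrow> card (nbhd G x) \<le> 2 * t"
    and sun: "\<And>x x'. \<lbrakk>x \<in> X; x' \<in> X; x \<noteq> x'\<rbrakk> \<Longrightarrow> nbhd G x \<inter> nbhd G x' = K"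
    and petal: "\<And>x. x \<in> X \<Longrightarrow> nbhd G x - K - R \<noteq> {}"
  defines "p \<equiv> int (card X)"
  shows "surplus t G (R \<union> (\<Union>x\<in>X. nbhd G x)) \<ge> surplus t G R + p * (p - 2 - 4 * int t * int t)"
proof -
  let ?B = "R \<union> (\<Union>x\<in>X. nbhd G x)"
  have finV: "finite (verts G)" using G by (rule simple_graph_finite)
  have finX: "finite X" and finR: "finite R" using finV X R finite_subset by blast+
  have finB: "finite ?B" using finR finX finite_nbhd[OF G] by simp
  have "\<exists>y. \<forall>x\<in>X. y x \<in> nbhd G x - K - R" using petal by (intro bchoice) blast
  then obtain y where y: "\<And>x. x \<in> X \<Longrightarrow> y x \<in> nbhd G x" "\<And>x. x \<in> X \<Longrightarrow> y x \<notin> K"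
    "\<And>x. x \<in> X \<Longrightarrow> y x \<notin> R" by blast
  \<comment> \<open>A common \<open>(r - 2)\<close>-clique of \<open>y x\<close> and \<open>x'\<close> cannot lie in the kernel, as \<open>x\<close> is adjacent to
    all of the kernel and to \<open>y x\<close>.\<close>
  have ex: "\<exists>z. z \<in> nbhd G x' - K \<and> {y x, z} \<in> edges G"
    if x: "x \<in> X" "x' \<in> X" "x \<noteq> x'" "y x \<noteq> x'" for x x'
  proof -
    \<comment> \<open>A vertex common to two of the neighbourhoods lies in the kernel, which
      \<open>y x\<close> avoids.\<close>
    have "y x \<notin> nbhd G x'" using sun[OF x(1-3)] y x by blast
    then have na: "{y x, x'} \<notin> edges G" by (simp add: in_nbhd_iff[OF G] insert_commute)
    have V: "y x \<in> verts G" "x' \<in> verts G" "x \<in> verts G"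
      using y(1)[OF x(1)] X x by (auto simp: nbhd_def)
    obtain Q where Q: "complete_on G Q" "card Q = r - 2" "Q \<subseteq> nbhd G (y x)" "Q \<subseteq> nbhd G x'"
      using complete_saturated_common_clique[OF G sat V(1,2) x(4) na] by blast
    have "\<not> Q \<subseteq> K"
    proof
      assume "Q \<subseteq> K"
      then have Qx: "Q \<subseteq> nbhd G x" using sun[OF x(1-3)] by blast
      have yx: "y x \<in> nbhd G x" using y x by blast
      have "complete_on G (insert (y x) Q)" using complete_on_insert[OF G Q(1,3) V(1)] .
      moreover have "insert (y x) Q \<subseteq> nbhd G x" using Qx yx by simp
      ultimately have "complete_on G (insert x (insert (y x) Q))"
        using complete_on_insert[OF G _ _ V(3)] by blast
      moreover have "finite Q" using Qx finite_nbhd[OF G] finite_subset by blast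
      moreover have "x \<notin> insert (y x) Q" "y x \<notin> Q"
        using simple_graph_irrefl[OF G] Qx Q(3) yx by (auto simp: in_nbhd_iff[OF G] subset_iff)
      ultimately have "contains_complete r G" unfolding contains_complete_iff
        using Q(2) r by (intro exI[of _ "insert x (insert (y x) Q)"]) auto
      then show False using sat unfolding complete_saturated_def by blast
    qed
    then obtain z where "z \<in> Q" "z \<notin> K" by blast
    then show ?thesis using Q(3,4) by (auto simp: in_nbhd_iff[OF G, symmetric])
  qed
  define z where "z x x' = (SOME z. z \<in> nbhd G x' - K \<and> {y x, z} \<in> edges G)" for x x'
  have z: "z x x' \<in> nbhd G x'" "z x x' \<notin> K" "{y x, z x x'} \<in> edges G"
    if "x \<in> X" "x' \<in> X" "x \<noteq> x'" "y x \<noteq> x'" for x x'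
    using someI_ex[OF ex[OF that]] unfolding z_def by auto
  \<comment> \<open>Excluded are the diagonal and, for each \<open>x\<close>, at most the one pair
    with \<open>x' = y x\<close>, where there are no two distinct vertices to take a common clique
    of.\<close>
  define I where "I = {(x, x') \<in> X \<times> X. x \<noteq> x' \<and> y x \<noteq> x'}"
  have finI: "finite I" unfolding I_def using finX by (auto intro: finite_subset[of _ "X \<times> X"])
  have "X \<times> X \<subseteq> I \<union> (\<lambda>x. (x, x)) ` X \<union> (\<lambda>x. (x, y x)) ` X" unfolding I_def by auto
  then have "card (X \<times> X) \<le> card (I \<union> (\<lambda>x. (x, x)) ` X \<union> (\<lambda>x. (x, y x)) ` X)"
    using finX finI by (intro card_mono) auto
  also have "\<dots> \<le> card I + card ((\<lambda>x. (x, x)) ` X) + card ((\<lambda>x. (x, y x)) ` X)"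
    by (meson add_le_mono1 card_Un_le le_trans)
  also have "\<dots> \<le> card I + card X + card X"
    using card_image_le[OF finX] by (intro add_mono) auto
  finally have cardI: "card X * card X \<le> card I + card X + card X" by (simp add: card_cartesian_product)
  \<comment> \<open>Petals are disjoint, so a vertex outside of the kernel determines its petal.
    This recovers \<open>x\<close> from \<open>y x\<close>, and below \<open>x'\<close> from
    \<open>z x x'\<close>.\<close>
  have yinj: "x = x'" if "x \<in> X" "x' \<in> X" "y x = y x'" for x x'
    using sun[OF that(1,2)] y(1,2)[OF that(1)] y(1,2)[OF that(2)] that(3) by auto
  let ?g = "\<lambda>(x, x'). (y x, z x x')"
  have "inj_on ?g I"
  proof (rule inj_onI, clarify)
    fix a b c d assume I: "(a, b) \<in> I" "(c, d) \<in> I" and e: "y a = y c" "z a b = z c d"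
    have "a = c" using yinj e(1) I unfolding I_def by blast
    moreover have "b = d"
    proof (rule ccontr)
      assume "b \<noteq> d"
      then have "nbhd G b \<inter> nbhd G d = K" using I sun unfolding I_def by blast
      moreover have "z a b \<in> nbhd G b" "z a b \<notin> K" "z c d \<in> nbhd G d"
        using I z unfolding I_def by blast+
      ultimately show False using e(2) by auto
    qed
    ultimately show "a = c \<and> b = d" by simp
  qed
  then have "card (?g ` I) = card I" by (rule card_image)
  \<comment> \<open>The pairs are new because their first entry \<open>y x\<close> lies outside of
    \<open>R\<close>.\<close>
  moreover have "?g ` I \<subseteq> adj_pairs G ?B - adj_pairs G R"
  proof
    fix q assume "q \<in> ?g ` I"
    then obtain x x' where x: "x \<in> X" "x' \<in> X" "x \<noteq> x'" "y x \<noteq> x'" "q = (y x, z x x')"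
      unfolding I_def by auto
    have "y x \<in> ?B" "z x x' \<in> ?B" using y(1)[OF x(1)] z(1)[OF x(1-4)] x(1,2) by blast+
    then show "q \<in> adj_pairs G ?B - adj_pairs G R"
      using y(3)[OF x(1)] z(3)[OF x(1-4)] x(5) unfolding adj_pairs_def by simp
  qed
  ultimately have "card I \<le> card (adj_pairs G ?B - adj_pairs G R)"
    using card_mono[OF _ \<open>?g ` I \<subseteq> _\<close>] finite_adj_pairs[OF finB, of G] by auto
  moreover have sub: "adj_pairs G R \<subseteq> adj_pairs G ?B" unfolding adj_pairs_def by auto
  ultimately have pairs: "card (adj_pairs G R) + card I \<le> card (adj_pairs G ?B)"
    using card_Diff_subset[OF finite_adj_pairs[OF finR] sub]
      card_mono[OF finite_adj_pairs[OF finB] sub] by linarith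
  have "card (\<Union>x\<in>X. nbhd G x) \<le> (\<Sum>x\<in>X. card (nbhd G x))" by (rule card_UN_le[OF finX])
  also have "\<dots> \<le> (\<Sum>x\<in>X. 2 * t)" using low by (rule sum_mono)
  finally have cardB: "card ?B \<le> card R + card X * (2 * t)"
    using card_Un_le[of R "\<Union>x\<in>X. nbhd G x"] by simp
  have "int (card ?B) \<le> int (card R) + p * (2 * int t)"
    using of_nat_mono[OF cardB, where 'a = int] unfolding p_def by simp
  then have "int t * int (card ?B) \<le> int t * (int (card R) + p * (2 * int t))"
    by (rule mult_left_mono) simp
  moreover have "p * p \<le> int (card I) + 2 * p"
    using of_nat_mono[OF cardI, where 'a = int] unfolding p_def by simp
  ultimately show ?thesis using pairs unfolding surplus_def by (simp add: algebra_simps)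
qed

text \<open>Of the \<open>4 * t * t + 3 + d\<close> members of a sunflower at most one is lost
  because its petal lies in \<open>R\<close>. With \<open>p = 4 * t * t + 2 + d\<close> of them
  left, the gain \<open>p * (p - 2 - 4 * t * t)\<close> equals \<open>p * d\<close>, which is at
  least \<open>d\<close>.\<close>

lemma surplus_gain:
  fixes G :: "'a ugraph"
  assumes G: "simple_graph G" and sat: "complete_saturated r G" and r: "r \<ge> 2"
    and R: "R \<subseteq> verts G"
    and many: "card ((\<lambda>x. nbhd G x - R) ` {x \<in> verts G. degree G x \<le> 2 * t})
      > sunflower_bound (4 * t * t + 3 + d) (2 * t)" (is "card (_ ` ?L) > sunflower_bound ?q _")
  shows "\<exists>R'\<subseteq>verts G. surplus t G R' \<ge> surplus t G R + int d"
proof -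
  have finV: "finite (verts G)" using G by (rule simple_graph_finite)
  \<comment> \<open>One vertex is chosen for each trace \<open>nbhd G x - R\<close>. Distinct traces
    have distinct neighbourhoods, so the sunflower can be sought among the full
    neighbourhoods.\<close>
  have "\<exists>X0\<subseteq>?L. inj_on (\<lambda>x. nbhd G x - R) X0 \<and>
    (\<lambda>x. nbhd G x - R) ` ?L = (\<lambda>x. nbhd G x - R) ` X0"
    by (rule iffD1[OF subset_image_inj order_refl])
  then obtain X0 where X0: "X0 \<subseteq> ?L" "inj_on (\<lambda>x. nbhd G x - R) X0"
    "(\<lambda>x. nbhd G x - R) ` ?L = (\<lambda>x. nbhd G x - R) ` X0"
    by (elim exE conjE)
  have inj: "inj_on (nbhd G) X0" using X0(2) unfolding inj_on_def by simp
  have fin0: "finite X0" using X0(1) finV by (auto intro: finite_subset[of X0 "verts G"])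
  have "card (nbhd G ` X0) > sunflower_bound ?q (2 * t)"
    using many unfolding X0(3) card_image[OF X0(2)] card_image[OF inj] .
  moreover have "finite A \<and> card A \<le> 2 * t" if "A \<in> nbhd G ` X0" for A
    using that X0(1) finite_nbhd[OF G] by (auto simp: degree_nbhd)
  ultimately have "\<exists>S\<subseteq>nbhd G ` X0. \<exists>K. card S = ?q \<and>
      (\<forall>A\<in>S. \<forall>B\<in>S. A \<noteq> B \<longrightarrow> A \<inter> B = K)"
    using finite_imageI[OF fin0] by (intro sunflower)
  then obtain S K where S: "S \<subseteq> nbhd G ` X0" "card S = ?q"
    "\<forall>A\<in>S. \<forall>B\<in>S. A \<noteq> B \<longrightarrow> A \<inter> B = K"
    by (elim exE conjE)
  obtain X1 where X1: "X1 \<subseteq> X0" "S = nbhd G ` X1"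
    using iffD1[OF subset_image_iff S(1)] by (elim exE conjE)
  have inj1: "inj_on (nbhd G) X1" using inj X1(1) inj_on_subset by blast
  have card1: "card X1 = ?q" using S(2) unfolding X1(2) card_image[OF inj1] .
  have sun: "nbhd G x \<inter> nbhd G x' = K" if "x \<in> X1" "x' \<in> X1" "x \<noteq> x'" for x x'
  proof -
    have "nbhd G x \<noteq> nbhd G x'" using inj_onD[OF inj1] that by blast
    then show ?thesis using S(3) that(1,2) unfolding X1(2) by simp
  qed
  \<comment> \<open>If the petals of \<open>x\<close> and \<open>x'\<close> both lie in
    \<open>R\<close>, then both traces equal \<open>K - R\<close>, whereas the chosen traces are
    distinct.\<close>
  have one_bad: "x = x'"
    if "x \<in> X1" "x' \<in> X1" "nbhd G x - K - R = {}" "nbhd G x' - K - R = {}" for x x'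
  proof (rule ccontr)
    assume "x \<noteq> x'"
    then have "nbhd G x - R = nbhd G x' - R" using sun[OF that(1,2)] that(3,4) by blast
    then show False using inj_onD[OF X0(2), of x x'] X1(1) that(1,2) \<open>x \<noteq> x'\<close> by auto
  qed
  have "\<exists>b. \<forall>x\<in>X1 - {b}. nbhd G x - K - R \<noteq> {}"
  proof (cases "\<exists>b\<in>X1. nbhd G b - K - R = {}")
    case True
    then obtain b where b: "b \<in> X1" "nbhd G b - K - R = {}" by (elim bexE)
    show ?thesis
    proof (intro exI[of _ b] ballI notI)
      fix x assume x: "x \<in> X1 - {b}" "nbhd G x - K - R = {}"
      then have "b = x" using one_bad[OF b(1) _ b(2)] by simp
      then show False using x(1) by simp
    qed
  qed simp
  then obtain b where b: "\<forall>x\<in>X1 - {b}. nbhd G x - K - R \<noteq> {}" by (elim exE)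
  have "card (X1 - {b}) \<ge> ?q - 1" using card1 by (simp add: card_Diff_singleton_if)
  then obtain X where X: "X \<subseteq> X1 - {b}" "card X = ?q - 1"
    by (rule obtain_subset_with_card_n)
  then have XX: "X \<subseteq> X1" "X \<subseteq> ?L" using X1(1) X0(1) by blast+
  have p: "int (card X) = 4 * int t * int t + 2 + int d" using X(2) by simp
  let ?B = "R \<union> (\<Union>x\<in>X. nbhd G x)"
  have "surplus t G ?B \<ge> surplus t G R + int (card X) * (int (card X) - 2 - 4 * int t * int t)"
  proof (rule surplus_gain_of_sunflower[OF G sat r R])
    show "X \<subseteq> verts G" using XX(2) by blast
    show "card (nbhd G x) \<le> 2 * t" if "x \<in> X" for x
      using that XX(2) by (auto simp: degree_nbhd)
    show "nbhd G x \<inter> nbhd G x' = K" if "x \<in> X" "x' \<in> X" "x \<noteq> x'" for x x'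
      using sun[of x x'] XX(1) that by blast
    show "nbhd G x - K - R \<noteq> {}" if "x \<in> X" for x using b X(1) that by (meson subsetD)
  qed
  moreover have "int (card X) * (int (card X) - 2 - 4 * int t * int t) = int (card X) * int d"
    using p by simp
  moreover have "int (card X) * int d \<ge> 1 * int d" using p by (intro mult_right_mono) auto
  moreover have "?B \<subseteq> verts G" using R by (auto simp: nbhd_def)
  ultimately show ?thesis by (intro exI[of _ ?B] conjI) linarith+
qed

text \<open>Pairs are charged to ends outside of \<open>R\<close>: an edge between \<open>R\<close>
  and the outside in both orientations to its only outer end, an edge with two outer ends in one
  orientation to each.\<close>

lemma card_adj_pairs_split:
  assumes G: "simple_graph G" and R: "R \<subseteq> verts G"
  shows "card (adj_pairs G (verts G)) = card (adj_pairs G R) +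
    (\<Sum>x\<in>verts G - R. 2 * card (nbhd G x \<inter> R) + card (nbhd G x - R))"
proof -
  let ?O = "verts G - R"
  let ?A = "Sigma ?O (\<lambda>x. nbhd G x \<inter> R)" and ?B = "Sigma ?O (\<lambda>x. nbhd G x - R)"
  have finV: "finite (verts G)" using G by (rule simple_graph_finite)
  have fins: "finite ?A" "finite ?B" "finite (prod.swap ` ?A)"
    using finV finite_nbhd[OF G] by (auto intro!: finite_SigmaI)
  have finR: "finite (adj_pairs G R)" using finite_adj_pairs R finV finite_subset by blast
  have eq: "adj_pairs G (verts G) = adj_pairs G R \<union> (prod.swap ` ?A \<union> (?A \<union> ?B))"
    unfolding adj_pairs_def using R nbhd_sym[OF G]
    by (auto simp: in_nbhd_iff[OF G] insert_commute image_iff dest: simple_graph_edge_verts[OF G])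
  have "card (adj_pairs G (verts G)) = card (adj_pairs G R) + card (prod.swap ` ?A \<union> (?A \<union> ?B))"
    unfolding eq using fins finR by (intro card_Un_disjoint) (auto simp: adj_pairs_def)
  also have "card (prod.swap ` ?A \<union> (?A \<union> ?B)) = card (prod.swap ` ?A) + card (?A \<union> ?B)"
    using fins by (intro card_Un_disjoint) auto
  also have "card (?A \<union> ?B) = card ?A + card ?B" using fins by (intro card_Un_disjoint) auto
  also have "card (prod.swap ` ?A) = card ?A" by (intro card_image inj_onI) auto
  also have "card ?A = (\<Sum>x\<in>?O. card (nbhd G x \<inter> R))"
    using finV finite_nbhd[OF G] by (intro card_SigmaI) auto
  also have "card ?B = (\<Sum>x\<in>?O. card (nbhd G x - R))"
    using finV finite_nbhd[OF G] by (intro card_SigmaI) auto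
  finally show ?thesis by (simp add: sum.distrib mult_2)
qed

lemma card_adj_pairs_verts:
  assumes G: "simple_graph G"
  shows "card (adj_pairs G (verts G)) = 2 * card (edges G)"
proof -
  have finE: "finite (edges G)" using G by (rule finite_edges)
  let ?f = "\<lambda>e. {(u, v). {u, v} = e}"
  have two: "card (?f e) = 2" "finite (?f e)" if "e \<in> edges G" for e
  proof -
    obtain a b where ab: "e = {a, b}" "a \<noteq> b"
      using G \<open>e \<in> edges G\<close> unfolding simple_graph_def by (meson card_2_iff)
    then have "?f e = {(a, b), (b, a)}" by (auto simp: doubleton_eq_iff)
    then show "card (?f e) = 2" "finite (?f e)" using ab by auto
  qed
  have "adj_pairs G (verts G) = (\<Union>e\<in>edges G. ?f e)"
    unfolding adj_pairs_def by (auto dest: simple_graph_edge_verts[OF G])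
  also have "card \<dots> = (\<Sum>e\<in>edges G. card (?f e))"
    using finE two(2) by (intro card_UN_disjoint) auto
  finally show ?thesis using two(1) by simp
qed

lemma surplus_verts:
  "simple_graph G \<Longrightarrow>
    surplus t G (verts G) = 2 * (int (card (edges G)) - int t * int (card (verts G)))"
  unfolding surplus_def by (simp add: card_adj_pairs_verts)

text \<open>Each vertex outside of \<open>R\<close> costs \<open>2 * t\<close>. A low one sends its
  at least \<open>t\<close> edges into \<open>R\<close>, where each counts twice; any other has more
  than \<open>2 * t\<close> neighbours, each counted at least once. A degree other than
  \<open>t\<close> leaves at least 1 to spare.\<close>

lemma surplus_verts_ge:
  assumes G: "simple_graph G" and R: "R \<subseteq> verts G"
    and deg: "\<And>v. v \<in> verts G \<Longrightarrow> degree G v \<ge> t"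
    and low: "\<And>x. x \<in> verts G \<Longrightarrow> degree G x \<le> 2 * t \<Longrightarrow> nbhd G x \<subseteq> R"
  shows "surplus t G (verts G) \<ge> surplus t G R + int (card {x \<in> verts G - R. degree G x \<noteq> t})"
proof -
  let ?O = "verts G - R"
  have finV: "finite (verts G)" using G by (rule simple_graph_finite)
  have pt: "2 * t + (if degree G x \<noteq> t then 1 else 0)
      \<le> 2 * card (nbhd G x \<inter> R) + card (nbhd G x - R)" if "x \<in> ?O" for x
  proof (cases "degree G x \<le> 2 * t")
    case True
    then have "nbhd G x \<inter> R = nbhd G x" using low that by blast
    then show ?thesis using deg[of x] that by (auto simp: degree_nbhd)
  next
    case False
    have "card (nbhd G x) = card (nbhd G x \<inter> R) + card (nbhd G x - R)"
      using finite_nbhd[OF G] by (metis card_Int_Diff)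
    then show ?thesis using False by (auto simp: degree_nbhd)
  qed
  have "card (verts G) = card R + card ?O"
    using finV R by (simp add: card_Diff_subset card_mono finite_subset)
  moreover have "2 * t * card ?O + card {x \<in> ?O. degree G x \<noteq> t}
      = (\<Sum>x\<in>?O. 2 * t + (if degree G x \<noteq> t then 1 else 0))"
    using finV by (simp add: sum.distrib sum.If_cases Int_def)
  moreover have "\<dots> \<le> (\<Sum>x\<in>?O. 2 * card (nbhd G x \<inter> R) + card (nbhd G x - R))"
    using pt by (rule sum_mono)
  ultimately have h: "card (adj_pairs G R) + 2 * t * card ?O + card {x \<in> ?O. degree G x \<noteq> t}
      \<le> card (adj_pairs G (verts G))" "card (verts G) = card R + card ?O"
    using card_adj_pairs_split[OF G R] by simp_all
  have "int (card (adj_pairs G R)) + 2 * int t * int (card ?O)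
      + int (card {x \<in> ?O. degree G x \<noteq> t}) \<le> int (card (adj_pairs G (verts G)))"
    "int (card (verts G)) = int (card R) + int (card ?O)"
    using of_nat_mono[OF h(1), where 'a = int] h(2) by simp_all
  then show ?thesis unfolding surplus_def by (simp add: algebra_simps)
qed

section \<open>Near-maximality of the surplus of the whole vertex set\<close>

lemma card_Union_low_nbhds:
  assumes G: "simple_graph G"
    and few: "card ((\<lambda>x. nbhd G x - R) ` {x \<in> verts G. degree G x \<le> 2 * t}) \<le> M"
  shows "card (\<Union>x\<in>{x \<in> verts G. degree G x \<le> 2 * t}. nbhd G x - R) \<le> M * (2 * t)"
proof -
  let ?F = "(\<lambda>x. nbhd G x - R) ` {x \<in> verts G. degree G x \<le> 2 * t}"
  have "card (\<Union>?F) \<le> (\<Sum>A\<in>?F. card A)" by (rule card_Union_le_sum_card)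
  also have "\<dots> \<le> (\<Sum>A\<in>?F. 2 * t)"
  proof (rule sum_mono)
    fix A assume "A \<in> ?F"
    then obtain x where "degree G x \<le> 2 * t" "A = nbhd G x - R" by blast
    then show "card A \<le> 2 * t"
      using card_mono[OF finite_nbhd[OF G, of x], of "nbhd G x - R"] by (simp add: degree_nbhd)
  qed
  also have "\<dots> \<le> M * (2 * t)" using few by (simp only: sum_constant) (intro mult_le_mono, auto)
  finally show ?thesis .
qed

text \<open>The price, \<open>2 * t\<close> per vertex, of adding the sets
  \<open>nbhd G x - R\<close> of all low \<open>x\<close> to a maximiser \<open>R\<close>. The final
  summand 1 is the gain that maximality rules out.\<close>

definition surplus_loss :: "nat \<Rightarrow> nat" where
  "surplus_loss t = 2 * t * (sunflower_bound (4 * t * t + 3 + 1) (2 * t) * (2 * t))"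

text \<open>Nothing gains over a maximiser \<open>R\<close>, so low vertices have few traces outside
  of \<open>R\<close>. Adding these traces loses at most \<open>surplus_loss t\<close>, and passing
  from there to all vertices loses nothing.\<close>

lemma surplus_verts_almost_max:
  assumes G: "simple_graph G" and sat: "complete_saturated r G" and r: "r \<ge> 2"
    and deg: "\<And>v. v \<in> verts G \<Longrightarrow> degree G v \<ge> t" and T: "T \<subseteq> verts G"
  shows "surplus t G (verts G) \<ge> surplus t G T - int (surplus_loss t)"
proof -
  let ?L = "{x \<in> verts G. degree G x \<le> 2 * t}"
  let ?M = "sunflower_bound (4 * t * t + 3 + 1) (2 * t)"
  have finV: "finite (verts G)" using G by (rule simple_graph_finite)
  have "finite (surplus t G ` Pow (verts G))" "surplus t G ` Pow (verts G) \<noteq> {}"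
    using finV by auto
  then obtain R where R: "R \<subseteq> verts G" "surplus t G R = Max (surplus t G ` Pow (verts G))"
    using Max_in[of "surplus t G ` Pow (verts G)"] by (metis (no_types, lifting) PowD imageE)
  have max: "surplus t G S \<le> surplus t G R" if "S \<subseteq> verts G" for S
    unfolding R(2) using finV that by (intro Max_ge) auto
  have few: "card ((\<lambda>x. nbhd G x - R) ` ?L) \<le> ?M"
  proof (rule ccontr)
    assume "\<not> ?thesis"
    then have "\<exists>R'\<subseteq>verts G. surplus t G R' \<ge> surplus t G R + int 1"
      by (intro surplus_gain[OF G sat r R(1)]) (simp only: not_le)
    then obtain R' where "R' \<subseteq> verts G" "surplus t G R' \<ge> surplus t G R + int 1"
      by (elim exE conjE)
    then show False using max[of R'] by simp
  qed
  let ?W = "\<Union>x\<in>?L. nbhd G x - R"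
  have W: "?W \<subseteq> verts G" by (auto simp: nbhd_def)
  have RW: "R \<union> ?W \<subseteq> verts G" using R W by blast
  have "nbhd G x \<subseteq> R \<union> ?W" if "x \<in> verts G" "degree G x \<le> 2 * t" for x
    using that by auto
  from surplus_verts_ge[OF G RW deg this]
  have "surplus t G (verts G) \<ge> surplus t G (R \<union> ?W)" by simp
  moreover have "surplus t G (R \<union> ?W) \<ge> surplus t G R - int (surplus_loss t)"
  proof -
    have "card (R \<union> ?W) \<le> card R + ?M * (2 * t)"
      using card_Un_le[of R ?W] card_Union_low_nbhds[OF G few] by linarith
    then have "2 * t * card (R \<union> ?W) \<le> 2 * t * (card R + ?M * (2 * t))" by (rule mult_le_mono2)
    then have "2 * t * card (R \<union> ?W) \<le> 2 * t * card R + surplus_loss t"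
      unfolding surplus_loss_def by (simp only: distrib_left)
    from of_nat_mono[OF this, where 'a = int]
    have "2 * int t * int (card (R \<union> ?W)) \<le> 2 * int t * int (card R) + int (surplus_loss t)"
      by simp
    moreover have "card (adj_pairs G R) \<le> card (adj_pairs G (R \<union> ?W))"
      using finV RW by (intro card_mono finite_adj_pairs) (auto simp: adj_pairs_def intro: finite_subset)
    ultimately show ?thesis unfolding surplus_def by simp
  qed
  ultimately show ?thesis using max[OF T] by linarith
qed

text \<open>The \<open>nat\<close> term is a gain over the empty set, of surplus 0, that
  near-maximality forbids when the whole vertex set has surplus \<open>2 * k\<close>.\<close>

definition class_bound :: "nat \<Rightarrow> int \<Rightarrow> nat" where
  "class_bound t k =
     sunflower_bound (4 * t * t + 3 + nat (2 * k + int (surplus_loss t) + 1)) (2 * t)"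

text \<open>With \<open>W\<close> the union of the low neighbourhoods, at most
  \<open>nat (2 * k) + 2 * t * card W\<close> irregular vertices lie outside of \<open>W\<close> and
  at most \<open>card W\<close> inside.\<close>

definition irregular_bound :: "nat \<Rightarrow> int \<Rightarrow> nat" where
  "irregular_bound t k = nat (2 * k) + (2 * t + 1) * (class_bound t k * (2 * t))"

text \<open>A large gain over \<open>R = {}\<close> would contradict near-maximality; this bounds
  the number of neighbourhoods. Their union \<open>?W\<close> has surplus at least
  \<open>- 2 * t * card ?W\<close>, and each vertex outside of \<open>?W\<close> with degree other
  than \<open>t\<close> adds at least 1 on the way to the total \<open>2 * k\<close>.\<close>

lemma few_classes:
  assumes G: "simple_graph G" and sat: "complete_saturated r G" and r: "r \<ge> 2"
    and deg: "\<And>v. v \<in> verts G \<Longrightarrow> degree G v \<ge> t"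
    and e: "int (card (edges G)) = int t * int (card (verts G)) + k"
  shows "card (nbhd G ` {x \<in> verts G. degree G x \<le> 2 * t}) \<le> class_bound t k"
    and "card {x \<in> verts G. degree G x \<noteq> t} \<le> irregular_bound t k"
proof -
  let ?L = "{x \<in> verts G. degree G x \<le> 2 * t}"
  let ?d = "nat (2 * k + int (surplus_loss t) + 1)"
  have finV: "finite (verts G)" using G by (rule simple_graph_finite)
  have total: "surplus t G (verts G) = 2 * k" using e surplus_verts[OF G] by simp
  have few: "card ((\<lambda>x. nbhd G x - {}) ` ?L) \<le> class_bound t k"
  proof (rule ccontr)
    assume "\<not> ?thesis"
    then have "\<exists>R'\<subseteq>verts G. surplus t G R' \<ge> surplus t G {} + int ?d"
      unfolding class_bound_def not_le by (intro surplus_gain[OF G sat r empty_subsetI])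
    then obtain R' where R': "R' \<subseteq> verts G" "surplus t G R' \<ge> surplus t G {} + int ?d"
      by (elim exE conjE)
    moreover have "surplus t G {} = 0" by (simp add: surplus_def adj_pairs_def)
    ultimately have "surplus t G R' \<ge> int ?d" by simp
    then show False
      using surplus_verts_almost_max[OF G sat r deg R'(1)] total by linarith
  qed
  then show "card (nbhd G ` ?L) \<le> class_bound t k" by simp
  let ?W = "\<Union>x\<in>?L. nbhd G x - {}"
  have W: "?W \<subseteq> verts G" by (auto simp: nbhd_def)
  have cW: "card ?W \<le> class_bound t k * (2 * t)" using card_Union_low_nbhds[OF G few] .
  have "surplus t G (verts G) \<ge> surplus t G ?W + int (card {x \<in> verts G - ?W. degree G x \<noteq> t})"
    by (rule surplus_verts_ge[OF G W deg]) auto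
  then have "int (card {x \<in> verts G - ?W. degree G x \<noteq> t}) \<le> 2 * k + 2 * int t * int (card ?W)"
    unfolding total unfolding surplus_def by simp
  then have "card {x \<in> verts G - ?W. degree G x \<noteq> t} \<le> nat (2 * k) + 2 * t * card ?W"
    unfolding zle_int[symmetric] by simp
  moreover have "card {x \<in> verts G. degree G x \<noteq> t}
      \<le> card ({x \<in> verts G - ?W. degree G x \<noteq> t} \<union> ?W)"
    using finV W finite_subset[OF W finV] by (intro card_mono) auto
  moreover have "\<dots> \<le> card {x \<in> verts G - ?W. degree G x \<noteq> t} + card ?W" by (rule card_Un_le)
  moreover have "(2 * t + 1) * card ?W \<le> (2 * t + 1) * (class_bound t k * (2 * t))"
    using cW by (rule mult_le_mono2)
  ultimately show "card {x \<in> verts G. degree G x \<noteq> t} \<le> irregular_bound t k"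
    unfolding irregular_bound_def by simp
qed

subsection \<open>Blow-ups as collapsing maps\<close>

text \<open>\<open>\<pi>\<close> sends each copy to its original. Only vertices of \<open>S\<close>
  may have several copies, and multiplicities are left implicit as the sizes of the fibres.\<close>

definition collapse :: "'a ugraph \<Rightarrow> 'b ugraph \<Rightarrow> 'b set \<Rightarrow> ('a \<Rightarrow> 'b) \<Rightarrow> bool" where
  "collapse G H S \<pi> \<longleftrightarrow> \<pi> ` verts G = verts H \<and>
     (\<forall>u\<in>verts G. \<forall>v\<in>verts G. {u, v} \<in> edges G \<longleftrightarrow> {\<pi> u, \<pi> v} \<in> edges H) \<and>
     (\<forall>u\<in>verts G. \<forall>v\<in>verts G. \<pi> u = \<pi> v \<and> \<pi> u \<notin> S \<longrightarrow> u = v)"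

lemma blow_up_edge_iff:
  "{(a, i), (b, j)} \<in> edges (blow_up H m) \<longleftrightarrow> {a, b} \<in> edges H \<and> i < m a \<and> j < m b"
proof
  assume "{(a, i), (b, j)} \<in> edges (blow_up H m)"
  then obtain u k v l where "{(a, i), (b, j)} = {(u, k), (v, l)}" "{u, v} \<in> edges H" "k < m u" "l < m v"
    unfolding blow_up_def by auto
  then show "{a, b} \<in> edges H \<and> i < m a \<and> j < m b"
    by (auto simp: doubleton_eq_iff insert_commute)
qed (auto simp: blow_up_def)

text \<open>The isomorphism is followed by the first projection. This is onto since every vertex of
  \<open>H\<close> has at least the copy with index 0.\<close>

lemma obtained_by_blowing_up_imp_collapse:
  assumes "obtained_by_blowing_up G H S"
  obtains \<pi> where "collapse G H S \<pi>"
proof -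
  from assms obtain m f where m: "\<forall>v\<in>S. m v \<ge> 1" "\<forall>v\<in>verts H - S. m v = 1"
    and f: "bij_betw f (verts G) (verts (blow_up H m))"
    and adj: "\<forall>u\<in>verts G. \<forall>v\<in>verts G. {u, v} \<in> edges G \<longleftrightarrow> {f u, f v} \<in> edges (blow_up H m)"
    unfolding obtained_by_blowing_up_def isomorphic_def by blast
  have V: "verts (blow_up H m) = (SIGMA v:verts H. {..<m v})" by (simp add: blow_up_def)
  have im: "f ` verts G = (SIGMA v:verts H. {..<m v})" using f V by (simp add: bij_betw_def)
  have mem: "fst (f u) \<in> verts H" "snd (f u) < m (fst (f u))" if "u \<in> verts G" for u
  proof -
    have "(fst (f u), snd (f u)) \<in> (SIGMA v:verts H. {..<m v})"
      unfolding prod.collapse im[symmetric] using that by (rule imageI)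
    then show "fst (f u) \<in> verts H" "snd (f u) < m (fst (f u))"
      unfolding mem_Sigma_iff by simp_all
  qed
  have pos: "(v, 0) \<in> (SIGMA v:verts H. {..<m v})" if "v \<in> verts H" for v
    using m that by (cases "v \<in> S") auto
  have "collapse G H S (\<lambda>u. fst (f u))" unfolding collapse_def
  proof (intro conjI ballI impI)
    show "(\<lambda>u. fst (f u)) ` verts G = verts H"
    proof
      show "verts H \<subseteq> (\<lambda>u. fst (f u)) ` verts G"
      proof
        fix v assume "v \<in> verts H"
        then obtain u where "u \<in> verts G" "(v, 0) = f u" using pos im by blast
        then show "v \<in> (\<lambda>u. fst (f u)) ` verts G" by (metis fst_conv imageI)
      qed
    qed (use mem in auto)
  next
    fix u v assume "u \<in> verts G" "v \<in> verts G"
    then show "{u, v} \<in> edges G \<longleftrightarrow> {fst (f u), fst (f v)} \<in> edges H"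
      using adj mem blow_up_edge_iff[of "fst (f u)" "snd (f u)" "fst (f v)" "snd (f v)" H m] by simp
  next
    fix u v assume uv: "u \<in> verts G" "v \<in> verts G" "fst (f u) = fst (f v) \<and> fst (f u) \<notin> S"
    then have "m (fst (f u)) = 1" "m (fst (f v)) = 1" using m(2) mem(1) by auto
    then have "f u = f v" using mem(2)[OF uv(1)] mem(2)[OF uv(2)] uv(3) by (simp add: prod_eq_iff)
    then show "u = v" using f uv(1,2) by (auto simp: bij_betw_def inj_on_def)
  qed
  then show ?thesis by (rule that)
qed

text \<open>The multiplicity of a vertex is the size of its fibre, and numbering each fibre by
  \<open>h\<close> provides the copy indices.\<close>

lemma collapse_imp_obtained_by_blowing_up:
  assumes fin: "finite (verts G)" and "S \<subseteq> verts H" and c: "collapse G H S \<pi>"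
  shows "obtained_by_blowing_up G H S"
proof -
  define F where "F v = {u \<in> verts G. \<pi> u = v}" for v
  have finF: "finite (F v)" for v using fin unfolding F_def by simp
  have "\<forall>v. \<exists>h. bij_betw h (F v) {0..<card (F v)}" using ex_bij_betw_finite_nat[OF finF] by blast
  then obtain h where h: "\<And>v. bij_betw (h v) (F v) {0..<card (F v)}" by metis
  have img: "\<pi> ` verts G = verts H" using c unfolding collapse_def by blast
  have pos: "card (F v) \<ge> 1" if "v \<in> verts H" for v
  proof -
    have "v \<in> \<pi> ` verts G" unfolding img using that .
    then obtain u where "u \<in> verts G" "v = \<pi> u" by (elim imageE)
    then have "u \<in> F v" unfolding F_def by simp
    then have "card (F v) \<noteq> 0" using finF[of v] card_0_eq by blast
    then show ?thesis by simp
  qed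
  have one: "card (F v) = 1" if "v \<in> verts H - S" for v
  proof -
    have "u = u'" if u: "u \<in> F v" "u' \<in> F v" for u u'
    proof -
      have "u \<in> verts G" "u' \<in> verts G" "\<pi> u = \<pi> u'" "\<pi> u \<notin> S"
        using u \<open>v \<in> verts H - S\<close> unfolding F_def by simp_all
      then show ?thesis using c unfolding collapse_def by blast
    qed
    then have "card (F v) \<le> Suc 0" using card_le_Suc0_iff_eq[OF finF[of v]] by blast
    moreover have "card (F v) \<ge> 1" using that by (intro pos) simp
    ultimately show ?thesis by simp
  qed
  let ?m = "\<lambda>v. card (F v)" and ?f = "\<lambda>u. (\<pi> u, h (\<pi> u) u)"
  have hF: "h (\<pi> u) u < card (F (\<pi> u))" if "u \<in> verts G" for u
    using bij_betwE[OF h[of "\<pi> u"]] that unfolding F_def by auto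
  have "isomorphic G (blow_up H ?m)" unfolding isomorphic_def
  proof (intro exI[of _ ?f] conjI ballI)
    have "inj_on ?f (verts G)"
    proof (rule inj_onI)
      fix u v assume uv: "u \<in> verts G" "v \<in> verts G" "?f u = ?f v"
      then have "u \<in> F (\<pi> u)" "v \<in> F (\<pi> u)" "h (\<pi> u) u = h (\<pi> u) v" unfolding F_def by auto
      then show "u = v" using bij_betw_imp_inj_on[OF h[of "\<pi> u"]] by (meson inj_onD)
    qed
    moreover have "?f ` verts G = (SIGMA v:verts H. {..<?m v})"
    proof
      show "?f ` verts G \<subseteq> (SIGMA v:verts H. {..<?m v})" using img hF by auto
      show "(SIGMA v:verts H. {..<?m v}) \<subseteq> ?f ` verts G"
      proof
        fix q assume "q \<in> (SIGMA v:verts H. {..<?m v})"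
        then obtain v i where q: "q = (v, i)" "v \<in> verts H" "i < ?m v" by auto
        then have "i \<in> h v ` F v" using bij_betw_imp_surj_on[OF h[of v]] by simp
        then obtain u where "u \<in> F v" "i = h v u" by blast
        then show "q \<in> ?f ` verts G" using q(1) unfolding F_def by auto
      qed
    qed
    ultimately show "bij_betw ?f (verts G) (verts (blow_up H ?m))"
      unfolding bij_betw_def blow_up_def by simp
  next
    fix u v assume "u \<in> verts G" "v \<in> verts G"
    then show "{u, v} \<in> edges G \<longleftrightarrow> {?f u, ?f v} \<in> edges (blow_up H ?m)"
      using c hF unfolding collapse_def blow_up_edge_iff by blast
  qed
  \<comment> \<open>\<open>S \<subseteq> verts H\<close> makes the fibres over \<open>S\<close>
    nonempty.\<close>
  then show ?thesis unfolding obtained_by_blowing_up_def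
    using pos one \<open>S \<subseteq> verts H\<close> by (intro exI[of _ ?m]) auto
qed

section \<open>Cliques, saturation, degrees and edge counts under collapsing maps\<close>

lemma collapse_nbhd_iff:
  assumes G: "simple_graph G" and H: "simple_graph H" and c: "collapse G H S \<pi>"
    and "u \<in> verts G" "v \<in> verts G"
  shows "v \<in> nbhd G u \<longleftrightarrow> \<pi> v \<in> nbhd H (\<pi> u)"
  using assms unfolding collapse_def in_nbhd_iff[OF G] in_nbhd_iff[OF H] by blast

text \<open>Adjacent vertices have distinct images because \<open>H\<close> has no loops, so cliques
  are mapped injectively.\<close>

lemma collapse_clique:
  assumes G: "simple_graph G" and H: "simple_graph H" and c: "collapse G H S \<pi>"
    and K: "complete_on G K"
  shows "complete_on H (\<pi> ` K)" "card (\<pi> ` K) = card K"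
proof -
  have KV: "K \<subseteq> verts G" using K unfolding complete_on_def by blast
  have adj: "{\<pi> u, \<pi> v} \<in> edges H" if "u \<in> K" "v \<in> K" "u \<noteq> v" for u v
    using complete_onD[OF K that] c KV that unfolding collapse_def by blast
  have "\<pi> ` K \<subseteq> verts H" using image_mono[OF KV, of \<pi>] c unfolding collapse_def by simp
  moreover have "{a, b} \<in> edges H" if "a \<in> \<pi> ` K" "b \<in> \<pi> ` K" "a \<noteq> b" for a b
  proof -
    obtain u v where "u \<in> K" "a = \<pi> u" "v \<in> K" "b = \<pi> v"
      using \<open>a \<in> \<pi> ` K\<close> \<open>b \<in> \<pi> ` K\<close> by (elim imageE)
    then show ?thesis using adj[of u v] \<open>a \<noteq> b\<close> by fastforce
  qed
  ultimately show "complete_on H (\<pi> ` K)" unfolding complete_on_def by blast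
  have "inj_on \<pi> K"
  proof (rule inj_onI, rule ccontr)
    fix u v assume "u \<in> K" "v \<in> K" "\<pi> u = \<pi> v" "u \<noteq> v"
    then show False using adj[of u v] simple_graph_irrefl[OF H] by simp
  qed
  then show "card (\<pi> ` K) = card K" by (rule card_image)
qed

text \<open>Any choice of one preimage per vertex of \<open>Q\<close> works, as adjacency is decided
  by the images.\<close>

lemma collapse_clique_lift:
  assumes c: "collapse G H S \<pi>" and Q: "complete_on H Q"
  obtains K where "complete_on G K" "\<pi> ` K = Q" "card K = card Q"
proof -
  have "Q \<subseteq> \<pi> ` verts G" using c Q unfolding collapse_def complete_on_def by blast
  from iffD1[OF subset_image_inj this]
  obtain K where K: "K \<subseteq> verts G" "inj_on \<pi> K" "Q = \<pi> ` K" by (elim exE conjE)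
  have "{u, v} \<in> edges G" if "u \<in> K" "v \<in> K" "u \<noteq> v" for u v
  proof -
    have "\<pi> u \<noteq> \<pi> v" using K(2) that by (meson inj_onD)
    then have "{\<pi> u, \<pi> v} \<in> edges H" using complete_onD[OF Q, of "\<pi> u" "\<pi> v"] that K(3) by simp
    then show ?thesis using c that K(1) unfolding collapse_def by blast
  qed
  then have "complete_on G K" using K(1) unfolding complete_on_def by blast
  then show ?thesis using that[of K] K card_image[OF K(2)] by simp
qed

lemma collapse_contains_complete:
  assumes G: "simple_graph G" and H: "simple_graph H" and c: "collapse G H S \<pi>"
  shows "contains_complete r G \<longleftrightarrow> contains_complete r H"
proof
  assume "contains_complete r G"
  then obtain K where "complete_on G K" "card K = r" unfolding contains_complete_iff by blast
  then show "contains_complete r H"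
    using collapse_clique[OF G H c, of K] unfolding contains_complete_iff by metis
next
  assume "contains_complete r H"
  then obtain Q where Q: "complete_on H Q" "card Q = r" unfolding contains_complete_iff by blast
  obtain K where "complete_on G K" "card K = card Q" using collapse_clique_lift[OF c Q(1)] by metis
  then show "contains_complete r G" using Q(2) unfolding contains_complete_iff by metis
qed

text \<open>Preimages of non-adjacent vertices are non-adjacent, and the image of their common
  clique serves the original pair.\<close>

lemma complete_saturated_blow_down:
  assumes G: "simple_graph G" and H: "simple_graph H" and c: "collapse G H S \<pi>"
    and r: "r \<ge> 2" and sat: "complete_saturated r G"
  shows "complete_saturated r H"
proof (rule complete_saturatedI[OF H r])
  show "\<not> contains_complete r H"
    using sat collapse_contains_complete[OF G H c] unfolding complete_saturated_def by blast
next
  fix a b assume ab: "a \<in> verts H" "b \<in> verts H" "a \<noteq> b" "{a, b} \<notin> edges H"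
  have img: "\<pi> ` verts G = verts H" using c unfolding collapse_def by blast
  obtain u where u: "u \<in> verts G" "a = \<pi> u" using ab(1) img by blast
  obtain v where v: "v \<in> verts G" "b = \<pi> v" using ab(2) img by blast
  have "{u, v} \<notin> edges G" using c u v ab(4) unfolding collapse_def by blast
  moreover have "u \<noteq> v" using u(2) v(2) ab(3) by blast
  ultimately obtain Q where Q: "complete_on G Q" "card Q = r - 2" "Q \<subseteq> nbhd G u" "Q \<subseteq> nbhd G v"
    using complete_saturated_common_clique[OF G sat u(1) v(1)] by blast
  have QV: "Q \<subseteq> verts G" using Q(1) unfolding complete_on_def by blast
  have "\<pi> ` Q \<subseteq> nbhd H a" "\<pi> ` Q \<subseteq> nbhd H b"
    unfolding u(2) v(2) image_subset_iff
    using collapse_nbhd_iff[OF G H c u(1)] collapse_nbhd_iff[OF G H c v(1)] Q(3,4) QV by blast+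
  then show "\<exists>Q. complete_on H Q \<and> card Q = r - 2 \<and> Q \<subseteq> nbhd H a \<and> Q \<subseteq> nbhd H b"
    using collapse_clique[OF G H c Q(1)] Q(2) by (intro exI[of _ "\<pi> ` Q"]) simp
qed

text \<open>Non-adjacent vertices with different images inherit a common clique from
  \<open>H\<close>. Two copies of the same vertex are a non-edge without counterpart in
  \<open>H\<close>; for these the hypothesis on \<open>S\<close> supplies the clique.\<close>

lemma complete_saturated_blow_up:
  assumes G: "simple_graph G" and H: "simple_graph H" and c: "collapse G H S \<pi>"
    and r: "r \<ge> 2" and sat: "complete_saturated r H"
    and S: "\<And>v. v \<in> S \<Longrightarrow> v \<in> verts H \<Longrightarrow> \<exists>Q. complete_on H Q \<and> card Q = r - 2 \<and> Q \<subseteq> nbhd H v"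
  shows "complete_saturated r G"
proof (rule complete_saturatedI[OF G r])
  show "\<not> contains_complete r G"
    using sat collapse_contains_complete[OF G H c] unfolding complete_saturated_def by blast
next
  fix u v assume uv: "u \<in> verts G" "v \<in> verts G" "u \<noteq> v" "{u, v} \<notin> edges G"
  have V: "\<pi> u \<in> verts H" "\<pi> v \<in> verts H" using c uv unfolding collapse_def by blast+
  have "\<exists>Q. complete_on H Q \<and> card Q = r - 2 \<and> Q \<subseteq> nbhd H (\<pi> u) \<and> Q \<subseteq> nbhd H (\<pi> v)"
  proof (cases "\<pi> u = \<pi> v")
    case True
    then have "\<pi> u \<in> S" using c uv unfolding collapse_def by blast
    from S[OF this V(1)] show ?thesis unfolding True[symmetric] by simp
  next
    case False
    have "{\<pi> u, \<pi> v} \<notin> edges H" using c uv unfolding collapse_def by blast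
    then show ?thesis by (rule complete_saturated_common_clique[OF H sat V False]) blast
  qed
  then obtain Q where Q: "complete_on H Q" "card Q = r - 2"
    "Q \<subseteq> nbhd H (\<pi> u)" "Q \<subseteq> nbhd H (\<pi> v)" by blast
  obtain K where K: "complete_on G K" "\<pi> ` K = Q" "card K = card Q"
    using collapse_clique_lift[OF c Q(1)] .
  have KV: "K \<subseteq> verts G" using K(1) unfolding complete_on_def by blast
  have "K \<subseteq> nbhd G u" "K \<subseteq> nbhd G v"
    using collapse_nbhd_iff[OF G H c uv(1)] collapse_nbhd_iff[OF G H c uv(2)] Q(3,4) KV K(2) by blast+
  then show "\<exists>Q. complete_on G Q \<and> card Q = r - 2 \<and> Q \<subseteq> nbhd G u \<and> Q \<subseteq> nbhd G v"
    using K Q(2) by (intro exI[of _ K]) simp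
qed

text \<open>This serves pairs of copies of \<open>v\<close>. A non-neighbour of \<open>v\<close>
  yields the clique at once. If \<open>v\<close> is adjacent to all others, the clique comes from a
  non-edge elsewhere, or, if \<open>H\<close> is complete, from any \<open>r - 2\<close> neighbours,
  which the degree bound guarantees.\<close>

lemma complete_saturated_clique_in_nbhd:
  assumes H: "simple_graph H" and sat: "complete_saturated r H"
    and v: "v \<in> verts H" and deg: "degree H v \<ge> r - 2"
  shows "\<exists>Q. complete_on H Q \<and> card Q = r - 2 \<and> Q \<subseteq> nbhd H v"
proof (cases "\<exists>w\<in>verts H. w \<noteq> v \<and> {v, w} \<notin> edges H")
  case True
  then obtain w where "w \<in> verts H" "v \<noteq> w" "{v, w} \<notin> edges H" by blast
  then show ?thesis by (rule complete_saturated_common_clique[OF H sat v]) blast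
next
  case False
  then have dom: "w \<in> nbhd H v" if "w \<in> verts H" "w \<noteq> v" for w
    using that unfolding in_nbhd_iff[OF H] by blast
  show ?thesis
  proof (cases "\<exists>u\<in>verts H. \<exists>w\<in>verts H. u \<noteq> w \<and> {u, w} \<notin> edges H")
    case True
    then obtain u w where uw: "u \<in> verts H" "w \<in> verts H" "u \<noteq> w" "{u, w} \<notin> edges H" by blast
    have uv: "u \<noteq> v" using dom[OF uw(2)] uw(3,4) unfolding in_nbhd_iff[OF H] by blast
    obtain Q where Q: "complete_on H Q" "card Q = r - 2" "Q \<subseteq> nbhd H u"
      by (rule complete_saturated_common_clique[OF H sat uw])
    have QV: "Q \<subseteq> verts H" using Q(1) unfolding complete_on_def by blast
    show ?thesis
    proof (cases "v \<in> Q")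
      case False
      then have "Q \<subseteq> nbhd H v" using dom QV by blast
      then show ?thesis using Q by blast
    next
      case True
      \<comment> \<open>As \<open>u\<close> is adjacent to all of \<open>Q\<close>, the vertex
        \<open>v\<close> can be exchanged for \<open>u\<close>.\<close>
      have "complete_on H (insert u (Q - {v}))"
        using Q(3) by (intro complete_on_insert[OF H complete_on_subset[OF Q(1)] _ uw(1)]) auto
      moreover have "card (insert u (Q - {v})) = r - 2"
      proof -
        have "u \<notin> nbhd H u" unfolding in_nbhd_iff[OF H] by (rule simple_graph_irrefl[OF H])
        then have "u \<notin> Q" using Q(3) by (rule contra_subsetD[rotated])
        moreover have "finite Q" using Q(3) finite_nbhd[OF H] by (rule finite_subset)
        ultimately have "card (insert u (Q - {v})) = Suc (card (Q - {v}))" by simp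
        also have "\<dots> = card Q" using \<open>finite Q\<close> True by (rule card_Suc_Diff1)
        finally show ?thesis using Q(2) by (rule trans)
      qed
      moreover have "insert u (Q - {v}) \<subseteq> nbhd H v" using dom QV uw(1) uv by auto
      ultimately show ?thesis by blast
    qed
  next
    case False
    then have full: "complete_on H (verts H)" unfolding complete_on_def by blast
    obtain Q where Q: "Q \<subseteq> nbhd H v" "card Q = r - 2"
      using deg unfolding degree_nbhd by (rule obtain_subset_with_card_n)
    have "complete_on H Q"
      using full subset_trans[OF Q(1) nbhd_subset] by (rule complete_on_subset)
    then show ?thesis using Q by blast
  qed
qed

lemma collapse_degree_ge:
  assumes G: "simple_graph G" and H: "simple_graph H" and c: "collapse G H S \<pi>"
    and u: "u \<in> verts G"
  shows "degree G u \<ge> degree H (\<pi> u)"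
proof -
  have "nbhd H (\<pi> u) \<subseteq> \<pi> ` nbhd G u"
  proof
    fix b assume b: "b \<in> nbhd H (\<pi> u)"
    then have "b \<in> \<pi> ` verts G" using c nbhd_subset[of H "\<pi> u"] unfolding collapse_def by auto
    then obtain v where "v \<in> verts G" "b = \<pi> v" by blast
    then show "b \<in> \<pi> ` nbhd G u" using collapse_nbhd_iff[OF G H c u] b by blast
  qed
  then show ?thesis unfolding degree_nbhd by (rule surj_card_le[OF finite_nbhd[OF G]])
qed

text \<open>Blowing up preserves the number of edges minus \<open>t\<close> times the number of
  vertices, written here without subtraction. An extra copy of a vertex of \<open>S\<close> brings
  exactly \<open>t\<close> edges, because its neighbours lie over vertices outside of
  \<open>S\<close> and are not multiplied.\<close>

lemma collapse_edge_count:
  assumes G: "simple_graph G" and H: "simple_graph H" and c: "collapse G H S \<pi>"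
    and S: "pairwise_nonadjacent H S" "\<And>v. v \<in> S \<Longrightarrow> degree H v = t"
  shows "card (edges G) + t * card (verts H) = card (edges H) + t * card (verts G)"
proof -
  have finV: "finite (verts G)" using G by (rule simple_graph_finite)
  have img: "verts H = \<pi> ` verts G" using c unfolding collapse_def by blast
  have "verts H \<subseteq> \<pi> ` verts G" using img by simp
  \<comment> \<open>\<open>U\<close> has one vertex in every fibre and so induces a copy of
    \<open>H\<close>.\<close>
  from iffD1[OF subset_image_inj this]
  obtain U where U: "U \<subseteq> verts G" "inj_on \<pi> U" "verts H = \<pi> ` U" by (elim exE conjE)
  have rep: "\<exists>u\<in>U. \<pi> u = \<pi> x" if "x \<in> verts G" for x
  proof -
    have "\<pi> x \<in> \<pi> ` U" using that img U(3) by blast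
    then show ?thesis by auto
  qed
  have fib: "u = v" if "u \<in> verts G" "v \<in> verts G" "\<pi> u = \<pi> v" "\<pi> u \<notin> S" for u v
    using c that unfolding collapse_def by blast
  \<comment> \<open>A vertex outside of \<open>U\<close> shares its fibre with one in
    \<open>U\<close>, so its image is in \<open>S\<close>. Its neighbours have images outside of
    \<open>S\<close>, where fibres are single vertices, and hence lie in \<open>U\<close>.\<close>
  have out: "card (nbhd G x \<inter> U) = t \<and> nbhd G x - U = {}" if x: "x \<in> verts G - U" for x
  proof -
    obtain u where u: "u \<in> U" "\<pi> u = \<pi> x" using rep[of x] x by blast
    then have xS: "\<pi> x \<in> S" using fib[of u x] x U(1) by auto
    have sub: "nbhd G x \<subseteq> U"
    proof
      fix y assume y: "y \<in> nbhd G x"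
      then have yV: "y \<in> verts G" using nbhd_subset by fast
      have "\<pi> y \<in> nbhd H (\<pi> x)" using collapse_nbhd_iff[OF G H c _ yV, of x] x y by blast
      then have "\<pi> y \<notin> S" using S(1) xS unfolding pairwise_nonadjacent_def in_nbhd_iff[OF H] by blast
      moreover obtain y' where "y' \<in> U" "\<pi> y' = \<pi> y" using rep[OF yV] by blast
      ultimately show "y \<in> U" using fib[of y' y] yV U(1) by auto
    qed
    have "\<pi> ` nbhd G x = nbhd H (\<pi> x)"
    proof
      show "\<pi> ` nbhd G x \<subseteq> nbhd H (\<pi> x)"
      proof
        fix b assume "b \<in> \<pi> ` nbhd G x"
        then obtain y where "y \<in> nbhd G x" "b = \<pi> y" by blast
        moreover then have "y \<in> verts G" using nbhd_subset by fast
        ultimately show "b \<in> nbhd H (\<pi> x)" using collapse_nbhd_iff[OF G H c, of x y] x by blast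
      qed
      show "nbhd H (\<pi> x) \<subseteq> \<pi> ` nbhd G x"
      proof
        fix b assume b: "b \<in> nbhd H (\<pi> x)"
        then have "b \<in> \<pi> ` verts G" using nbhd_subset[of H "\<pi> x"] unfolding img[symmetric] by auto
        then obtain v where "v \<in> verts G" "b = \<pi> v" by blast
        then show "b \<in> \<pi> ` nbhd G x" using collapse_nbhd_iff[OF G H c, of x v] x b by blast
      qed
    qed
    moreover have "inj_on \<pi> (nbhd G x)" using U(2) sub by (rule inj_on_subset)
    ultimately have "card (nbhd G x) = t"
      using S(2)[OF xS] card_image[of \<pi> "nbhd G x"] by (simp add: degree_nbhd)
    moreover have "nbhd G x \<inter> U = nbhd G x" using sub by blast
    ultimately show ?thesis using sub by simp
  qed
  have "(\<Sum>x\<in>verts G - U. 2 * card (nbhd G x \<inter> U) + card (nbhd G x - U))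
      = (\<Sum>x\<in>verts G - U. 2 * t)"
  proof (rule sum.cong[OF refl])
    fix x assume "x \<in> verts G - U"
    then have "card (nbhd G x \<inter> U) = t" "nbhd G x - U = {}" using out by blast+
    then show "2 * card (nbhd G x \<inter> U) + card (nbhd G x - U) = 2 * t" by (simp only: card.empty)
  qed
  then have "card (adj_pairs G (verts G)) = card (adj_pairs G U) + 2 * (t * card (verts G - U))"
    unfolding card_adj_pairs_split[OF G U(1)] by (simp add: ac_simps)
  moreover have "card (adj_pairs G U) = card (adj_pairs H (verts H))"
  proof -
    have UH: "{u, v} \<in> edges G \<longleftrightarrow> {\<pi> u, \<pi> v} \<in> edges H" if "u \<in> U" "v \<in> U" for u v
      using c subsetD[OF U(1)] that unfolding collapse_def by blast
    have "inj_on (map_prod \<pi> \<pi>) (adj_pairs G U)"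
      using U(2) unfolding adj_pairs_def inj_on_def by auto
    moreover have "map_prod \<pi> \<pi> ` adj_pairs G U = adj_pairs H (verts H)"
    proof
      show "map_prod \<pi> \<pi> ` adj_pairs G U \<subseteq> adj_pairs H (verts H)"
        using UH unfolding adj_pairs_def U(3) by auto
      show "adj_pairs H (verts H) \<subseteq> map_prod \<pi> \<pi> ` adj_pairs G U"
      proof
        fix q assume "q \<in> adj_pairs H (verts H)"
        then obtain u v where q: "q = (\<pi> u, \<pi> v)" "u \<in> U" "v \<in> U" "{\<pi> u, \<pi> v} \<in> edges H"
          unfolding adj_pairs_def U(3) by auto
        then have "(u, v) \<in> adj_pairs G U"
          using UH unfolding adj_pairs_def by blast
        then show "q \<in> map_prod \<pi> \<pi> ` adj_pairs G U" using q(1) by (metis image_eqI map_prod_simp)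
      qed
    qed
    ultimately show ?thesis using card_image by metis
  qed
  ultimately have "card (edges G) = card (edges H) + t * card (verts G - U)"
    using card_adj_pairs_verts[OF G] card_adj_pairs_verts[OF H] by simp
  moreover have "card (verts G) = card (verts H) + card (verts G - U)"
    using card_Diff_subset[OF finite_subset[OF U(1) finV] U(1)] card_mono[OF finV U(1)]
      card_image[OF U(2)] U(3) by simp
  ultimately show ?thesis by (simp add: distrib_left)
qed

subsection \<open>Bounded cores\<close>

definition saturated_with :: "nat \<Rightarrow> nat \<Rightarrow> int \<Rightarrow> 'a ugraph \<Rightarrow> bool" where
  "saturated_with r t k G \<longleftrightarrow> complete_saturated r G \<and> min_degree G \<ge> t \<and>
     int (card (edges G)) = int t * int (card (verts G)) + k"

text \<open>All vertices of degree other than \<open>t\<close>, and at most \<open>t + 1\<close>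
  from each class of twins of degree \<open>t\<close>.\<close>

definition core_bound :: "nat \<Rightarrow> int \<Rightarrow> nat" where
  "core_bound t k = irregular_bound t k + class_bound t k * (t + 1)"

text \<open>Degrees do not drop and the edge count keeps \<open>k\<close>. As
  \<open>t \<ge> r - 2\<close>, the neighbourhood of a vertex of \<open>S\<close> contains the
  clique that two of its copies require.\<close>

lemma saturated_with_blow_up:
  assumes G: "simple_graph G" and H: "simple_graph H" and c: "collapse G H S \<pi>"
    and S: "pairwise_nonadjacent H S" "\<And>v. v \<in> S \<Longrightarrow> degree H v = t"
    and r: "r \<ge> 2" "t \<ge> r - 2" and H': "saturated_with r t k H"
  shows "saturated_with r t k G"
  unfolding saturated_with_def
proof (intro conjI)
  have sat: "complete_saturated r H" and md: "min_degree H \<ge> t"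
    and e: "int (card (edges H)) = int t * int (card (verts H)) + k"
    using H' unfolding saturated_with_def by auto
  show "complete_saturated r G"
    using S(2) r(2) complete_saturated_clique_in_nbhd[OF H sat]
    by (intro complete_saturated_blow_up[OF G H c r(1) sat]) auto
  show "min_degree G \<ge> t" unfolding min_degree_ge_iff[OF G]
  proof
    fix u assume u: "u \<in> verts G"
    then have "\<pi> u \<in> verts H" using c unfolding collapse_def by blast
    then have "degree H (\<pi> u) \<ge> t" using md unfolding min_degree_ge_iff[OF H] by blast
    then show "degree G u \<ge> t" using collapse_degree_ge[OF G H c u] by simp
  qed
  show "int (card (edges G)) = int t * int (card (verts G)) + k"
    using e arg_cong[OF collapse_edge_count[OF G H c S], of int] by simp
qed

text \<open>Relabelling by an initial segment of the naturals turns a bound on the order of cores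
  into finitely many candidates, whatever the vertex type of \<open>G\<close>.\<close>

lemma induced_subgraph_on_nat:
  assumes G: "simple_graph G" and U: "U \<subseteq> verts G" "U \<noteq> {}"
  obtains H :: "nat ugraph" and h where "simple_graph H" "verts H = {..<card U}"
    "bij_betw h U (verts H)"
    "\<And>u v. u \<in> U \<Longrightarrow> v \<in> U \<Longrightarrow> {h u, h v} \<in> edges H \<longleftrightarrow> {u, v} \<in> edges G"
proof -
  have finU: "finite U" using U(1) simple_graph_finite[OF G] finite_subset by blast
  obtain h where h: "bij_betw h U {0..<card U}" using ex_bij_betw_finite_nat[OF finU] by blast
  define H where "H = \<lparr>verts = {..<card U}, edges = {{h u, h v} |u v. u \<in> U \<and> v \<in> U \<and> {u, v} \<in> edges G}\<rparr>"
  have vH: "verts H = {..<card U}" unfolding H_def by simp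
  have inj: "inj_on h U" using h by (rule bij_betw_imp_inj_on)
  have hU: "h u < card U" if "u \<in> U" for u using bij_betwE[OF h] that by auto
  have adj: "{h u, h v} \<in> edges H \<longleftrightarrow> {u, v} \<in> edges G" if uv: "u \<in> U" "v \<in> U" for u v
  proof
    assume "{h u, h v} \<in> edges H"
    then obtain a b where ab: "{h u, h v} = {h a, h b}" "a \<in> U" "b \<in> U" "{a, b} \<in> edges G"
      unfolding H_def by auto
    from ab(1) have "(u = a \<and> v = b) \<or> (u = b \<and> v = a)"
      unfolding doubleton_eq_iff using inj_onD[OF inj] uv ab(2,3) by blast
    then show "{u, v} \<in> edges G" using ab(4) by (auto simp: insert_commute)
  qed (use uv in \<open>auto simp: H_def\<close>)
  have "simple_graph H" unfolding simple_graph_def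
  proof (intro conjI ballI)
    show "verts H \<noteq> {}" using vH finU U(2) by (simp add: lessThan_empty_iff)
    fix e assume "e \<in> edges H"
    then obtain a b where ab: "e = {h a, h b}" "a \<in> U" "b \<in> U" "{a, b} \<in> edges G"
      unfolding H_def by auto
    then have "a \<noteq> b" using simple_graph_edge_verts(3)[OF G] by blast
    then have "h a \<noteq> h b" using inj_onD[OF inj] ab(2,3) by blast
    then show "e \<subseteq> verts H" "card e = 2" using ab hU vH by auto
  qed (simp add: vH)
  moreover have "bij_betw h U (verts H)" using h vH by (simp add: atLeast0LessThan)
  ultimately show ?thesis using that vH adj by blast
qed

text \<open>In every class of more than \<open>t + 1\<close> twins of degree \<open>t\<close>, all
  but \<open>t + 1\<close> are deleted. The deleted ones become copies of one kept twin
  \<open>s B\<close>, and \<open>S\<close> consists of these chosen twins.\<close>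

lemma bounded_core:
  assumes G: "simple_graph G" and r: "r \<ge> 2" and GT: "saturated_with r t k G"
  obtains H :: "nat ugraph" and S \<pi> where "simple_graph H" "verts H \<subseteq> {..<core_bound t k}"
    "saturated_with r t k H" "S \<subseteq> verts H" "pairwise_nonadjacent H S"
    "\<And>v. v \<in> S \<Longrightarrow> degree H v = t" "collapse G H S \<pi>"
proof -
  have finV: "finite (verts G)" using G by (rule simple_graph_finite)
  have sat: "complete_saturated r G" and e: "int (card (edges G)) = int t * int (card (verts G)) + k"
    and deg: "\<And>v. v \<in> verts G \<Longrightarrow> degree G v \<ge> t"
    using GT unfolding saturated_with_def min_degree_ge_iff[OF G] by auto
  define cl where "cl B = {x \<in> verts G. degree G x = t \<and> nbhd G x = B}" for B
  have finC: "finite (cl B)" for B unfolding cl_def using finV by simp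
  have "\<forall>B. \<exists>T. card (cl B) > t + 1 \<longrightarrow> T \<subseteq> cl B \<and> card T = t + 1"
    by (metis less_imp_le obtain_subset_with_card_n)
  then obtain T where T: "\<And>B. card (cl B) > t + 1 \<Longrightarrow> T B \<subseteq> cl B"
    "\<And>B. card (cl B) > t + 1 \<Longrightarrow> card (T B) = t + 1" by metis
  define s where "s B = (SOME x. x \<in> T B)" for B
  have s: "s B \<in> T B" if "card (cl B) > t + 1" for B
  proof -
    have "T B \<noteq> {}" using T(2)[OF that] by auto
    then show ?thesis unfolding s_def by (simp add: some_in_eq)
  qed
  define U where
    "U = {x \<in> verts G. degree G x = t \<and> card (cl (nbhd G x)) > t + 1 \<longrightarrow> x \<in> T (nbhd G x)}"
  have UV: "U \<subseteq> verts G" unfolding U_def by blast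
  have TU: "T B \<subseteq> U" if "card (cl B) > t + 1" for B
    using T(1)[OF that] unfolding U_def cl_def by auto
  have notU: "degree G x = t" "card (cl (nbhd G x)) > t + 1" if "x \<in> verts G - U" for x
    using that unfolding U_def by auto
  have s': "s B \<in> U" "s B \<in> verts G" "nbhd G (s B) = B" "degree G (s B) = t"
    if "card (cl B) > t + 1" for B
    using s[OF that] TU[OF that] T(1)[OF that] unfolding cl_def by auto
  \<comment> \<open>A retraction onto the kept vertices; deleted vertices go to a twin, so that
    neighbourhoods do not change.\<close>
  define \<rho> where "\<rho> x = (if x \<in> U then x else s (nbhd G x))" for x
  have \<rho>: "\<rho> x \<in> U" "nbhd G (\<rho> x) = nbhd G x" if "x \<in> verts G" for x
    using s'[of "nbhd G x"] notU[of x] that unfolding \<rho>_def by auto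
  have "verts G \<noteq> {}" using G unfolding simple_graph_def by blast
  then have Une: "U \<noteq> {}" using \<rho>(1) by blast
  \<comment> \<open>Keeping \<open>t + 1\<close> vertices of a big class leaves its neighbours with degree above \<open>t\<close>, so that
    shrinking neither breaks the degree bound nor makes two representatives adjacent.\<close>
  have many: "card (nbhd G u \<inter> U) \<ge> t + 1" if u: "u \<in> B" and B: "card (cl B) > t + 1" for u B
  proof -
    have "T B \<subseteq> nbhd G u"
      using T(1)[OF B] u nbhd_sym[OF G, of u] unfolding cl_def by auto
    then have "T B \<subseteq> nbhd G u \<inter> U" using TU[OF B] by blast
    then have "card (T B) \<le> card (nbhd G u \<inter> U)" using finite_nbhd[OF G] by (intro card_mono) auto
    then show ?thesis using T(2)[OF B] by simp
  qed
  \<comment> \<open>A deleted neighbour of \<open>u\<close> belongs to a big class, and then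
    \<open>u\<close> is adjacent to all \<open>t + 1\<close> kept members of that class.\<close>
  have closed: "nbhd G u \<subseteq> U" if u: "u \<in> verts G" "card (nbhd G u \<inter> U) \<le> t" for u
  proof (rule ccontr)
    assume "\<not> ?thesis"
    then obtain x where x: "x \<in> nbhd G u" "x \<notin> U" by blast
    then have xV: "x \<in> verts G - U" using nbhd_subset[of G u] by blast
    have "u \<in> nbhd G x" using x(1) nbhd_sym[OF G] by blast
    then show False using many notU(2)[OF xV] u(2) by fastforce
  qed
  have sU: "nbhd G (s B) \<subseteq> U" if "card (cl B) > t + 1" for B
  proof (rule closed)
    show "s B \<in> verts G" using s'(2)[OF that] .
    have "card (nbhd G (s B) \<inter> U) \<le> card (nbhd G (s B))"
      using finite_nbhd[OF G] by (intro card_mono) auto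
    then show "card (nbhd G (s B) \<inter> U) \<le> t" using s'(4)[OF that] by (simp add: degree_nbhd)
  qed
  have cardU: "card U \<le> core_bound t k"
  proof -
    let ?L = "{x \<in> verts G. degree G x \<le> 2 * t}"
    let ?F = "nbhd G ` ?L"
    have finF: "finite ?F" using finV by simp
    have small: "card (cl B \<inter> U) \<le> t + 1" for B
    proof (cases "card (cl B) > t + 1")
      case True
      have "cl B \<inter> U \<subseteq> T B" using True unfolding U_def cl_def by auto
      moreover have "finite (T B)" using T(1)[OF True] finC finite_subset by blast
      ultimately show ?thesis using T(2)[OF True] card_mono by metis
    next
      case False
      then show ?thesis using card_mono[OF finC[of B], of "cl B \<inter> U"] by simp
    qed
    \<comment> \<open>Vertices of degree \<open>t\<close> are low, so their classes belong to
      neighbourhoods counted by \<open>class_bound\<close>.\<close>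
    have "U \<subseteq> {x \<in> verts G. degree G x \<noteq> t} \<union> (\<Union>B\<in>?F. cl B \<inter> U)"
    proof
      fix x assume x: "x \<in> U"
      show "x \<in> {x \<in> verts G. degree G x \<noteq> t} \<union> (\<Union>B\<in>?F. cl B \<inter> U)"
      proof (cases "degree G x = t")
        case True
        then have "x \<in> cl (nbhd G x)" "nbhd G x \<in> ?F" using x UV unfolding cl_def by auto
        then show ?thesis using x by blast
      qed (use x UV in auto)
    qed
    then have "card U \<le> card ({x \<in> verts G. degree G x \<noteq> t} \<union> (\<Union>B\<in>?F. cl B \<inter> U))"
      using finV finF finC by (intro card_mono finite_UnI finite_UN_I) auto
    also have "\<dots> \<le> card {x \<in> verts G. degree G x \<noteq> t} + card (\<Union>B\<in>?F. cl B \<inter> U)"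
      by (rule card_Un_le)
    also have "card (\<Union>B\<in>?F. cl B \<inter> U) \<le> (\<Sum>B\<in>?F. card (cl B \<inter> U))" by (rule card_UN_le[OF finF])
    also have "\<dots> \<le> (\<Sum>B\<in>?F. t + 1)" using small by (rule sum_mono)
    also have "\<dots> \<le> class_bound t k * (t + 1)"
      unfolding sum_constant of_nat_id using few_classes(1)[OF G sat r deg e] by (rule mult_le_mono1)
    also have "card {x \<in> verts G. degree G x \<noteq> t} \<le> irregular_bound t k"
      by (rule few_classes(2)[OF G sat r deg e])
    finally show ?thesis unfolding core_bound_def by simp
  qed
  obtain H :: "nat ugraph" and h where H: "simple_graph H" "verts H = {..<card U}"
    and h: "bij_betw h U (verts H)"
    and adj: "\<And>u v. u \<in> U \<Longrightarrow> v \<in> U \<Longrightarrow> {h u, h v} \<in> edges H \<longleftrightarrow> {u, v} \<in> edges G"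
    using induced_subgraph_on_nat[OF G UV Une] by blast
  have inj: "inj_on h U" and hU: "h ` U = verts H" using h unfolding bij_betw_def by auto
  have degH: "degree H (h u) = card (nbhd G u \<inter> U)" if u: "u \<in> U" for u
  proof -
    have "nbhd H (h u) = h ` (nbhd G u \<inter> U)"
    proof
      show "nbhd H (h u) \<subseteq> h ` (nbhd G u \<inter> U)"
      proof
        fix b assume b: "b \<in> nbhd H (h u)"
        then have "b \<in> h ` U" using nbhd_subset[of H] hU by blast
        then obtain v where "v \<in> U" "b = h v" by blast
        then show "b \<in> h ` (nbhd G u \<inter> U)"
          using b adj[OF u] unfolding in_nbhd_iff[OF H(1)] by (auto simp: in_nbhd_iff[OF G])
      qed
      show "h ` (nbhd G u \<inter> U) \<subseteq> nbhd H (h u)"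
        using adj[OF u] by (auto simp: in_nbhd_iff[OF G] in_nbhd_iff[OF H(1)])
    qed
    then show ?thesis unfolding degree_nbhd by (simp add: card_image inj_on_subset[OF inj])
  qed
  define S where "S = h ` {s B |B. card (cl B) > t + 1}"
  have S: "S \<subseteq> verts H" unfolding S_def using s'(1) hU by auto
  have degS: "degree H v = t" if v: "v \<in> S" for v
  proof -
    obtain B where B: "v = h (s B)" "card (cl B) > t + 1" using v unfolding S_def by blast
    have "nbhd G (s B) \<inter> U = nbhd G (s B)" using sU[OF B(2)] by blast
    then show ?thesis using degH[OF s'(1)[OF B(2)]] s'(4)[OF B(2)] B(1) by (simp add: degree_nbhd)
  qed
  have nonadj: "pairwise_nonadjacent H S" unfolding pairwise_nonadjacent_def
  proof (intro ballI notI)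
    fix a b assume ab: "a \<in> S" "b \<in> S" "{a, b} \<in> edges H"
    obtain A where A: "a = h (s A)" "card (cl A) > t + 1" using ab(1) unfolding S_def by blast
    obtain B where B: "b = h (s B)" "card (cl B) > t + 1" using ab(2) unfolding S_def by blast
    have "{s A, s B} \<in> edges G" using adj[OF s'(1)[OF A(2)] s'(1)[OF B(2)]] ab(3) A(1) B(1) by simp
    then have "s A \<in> nbhd G (s B)" by (simp add: in_nbhd_iff[OF G] insert_commute)
    then have "s A \<in> B" using s'(3)[OF B(2)] by simp
    \<comment> \<open>Being in \<open>B\<close>, the vertex \<open>s A\<close> has
      \<open>t + 1\<close> kept neighbours in the class of \<open>B\<close>, but its degree in
      \<open>H\<close> is \<open>t\<close>.\<close>
    from many[OF this B(2)] show False
      using degS[OF ab(1)] degH[OF s'(1)[OF A(2)]] A(1) by simp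
  qed
  \<comment> \<open>Twins are interchangeable as ends of an edge, so the two ends are replaced one
    after the other.\<close>
  have \<rho>adj: "{u, v} \<in> edges G \<longleftrightarrow> {\<rho> u, \<rho> v} \<in> edges G" if "u \<in> verts G" "v \<in> verts G" for u v
  proof -
    have "{u, v} \<in> edges G \<longleftrightarrow> v \<in> nbhd G (\<rho> u)" using \<rho>(2)[OF that(1)] in_nbhd_iff[OF G] by blast
    also have "\<dots> \<longleftrightarrow> \<rho> u \<in> nbhd G (\<rho> v)" using \<rho>(2)[OF that(2)] nbhd_sym[OF G] by blast
    finally show ?thesis using in_nbhd_iff[OF G] by (simp add: insert_commute)
  qed
  have c: "collapse G H S (\<lambda>x. h (\<rho> x))" unfolding collapse_def
  proof (intro conjI ballI impI)
    have "\<rho> ` verts G = U"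
    proof
      show "\<rho> ` verts G \<subseteq> U" using \<rho>(1) by blast
      show "U \<subseteq> \<rho> ` verts G"
      proof
        fix x assume "x \<in> U"
        then have "\<rho> x = x" "x \<in> verts G" using UV unfolding \<rho>_def by auto
        then show "x \<in> \<rho> ` verts G" by (metis imageI)
      qed
    qed
    then show "(\<lambda>x. h (\<rho> x)) ` verts G = verts H" using hU by (metis image_image)
  next
    fix u v assume uv: "u \<in> verts G" "v \<in> verts G"
    show "{u, v} \<in> edges G \<longleftrightarrow> {h (\<rho> u), h (\<rho> v)} \<in> edges H"
      using \<rho>adj[OF uv] adj[OF \<rho>(1)[OF uv(1)] \<rho>(1)[OF uv(2)]] by simp
  next
    fix u v assume uv: "u \<in> verts G" "v \<in> verts G" "h (\<rho> u) = h (\<rho> v) \<and> h (\<rho> u) \<notin> S"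
    have eq: "\<rho> u = \<rho> v" using inj_onD[OF inj _ \<rho>(1)[OF uv(1)] \<rho>(1)[OF uv(2)]] uv(3) by blast
    \<comment> \<open>Deleted vertices are mapped into \<open>S\<close>, so only kept ones, which
      \<open>\<rho>\<close> fixes, have images outside of \<open>S\<close>.\<close>
    have "x \<in> U" if "x \<in> verts G" "h (\<rho> x) \<notin> S" for x
    proof (rule ccontr)
      assume "x \<notin> U"
      then have "card (cl (nbhd G x)) > t + 1" "\<rho> x = s (nbhd G x)"
        using notU(2)[of x] that(1) unfolding \<rho>_def by auto
      then show False using that(2) unfolding S_def by blast
    qed
    then have "u \<in> U" "v \<in> U" using uv by auto
    then show "u = v" using eq unfolding \<rho>_def by simp
  qed
  have "saturated_with r t k H" unfolding saturated_with_def
  proof (intro conjI)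
    show "complete_saturated r H" using complete_saturated_blow_down[OF G H(1) c r sat] .
    show "min_degree H \<ge> t" unfolding min_degree_ge_iff[OF H(1)]
    proof
      fix a assume "a \<in> verts H"
      then obtain u where u: "u \<in> U" "a = h u" using hU by blast
      \<comment> \<open>Fewer than \<open>t\<close> kept neighbours would mean that no neighbour was
        deleted, against the degree of \<open>u\<close> in \<open>G\<close>.\<close>
      have "card (nbhd G u \<inter> U) \<ge> t"
      proof (rule ccontr)
        assume "\<not> ?thesis"
        then have lt: "card (nbhd G u \<inter> U) < t" by simp
        then have "nbhd G u \<inter> U = nbhd G u" using closed[of u] u(1) UV by auto
        then show False using lt deg[of u] u(1) UV by (auto simp: degree_nbhd)
      qed
      then show "degree H a \<ge> t" using degH[OF u(1)] u(2) by simp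
    qed
    show "int (card (edges H)) = int t * int (card (verts H)) + k"
      using e arg_cong[OF collapse_edge_count[OF G H(1) c nonadj degS], of int] by simp
  qed
  moreover have "verts H \<subseteq> {..<core_bound t k}" using cardU H(2) by auto
  ultimately show ?thesis using that[OF H(1) _ _ S nonadj degS c] by blast
qed

lemma finite_bounded_graphs: "finite {H :: nat ugraph. simple_graph H \<and> verts H \<subseteq> {..<N}}"
proof (rule finite_subset)
  let ?g = "\<lambda>(V, E). \<lparr>verts = V, edges = E\<rparr> :: nat ugraph"
  show "{H :: nat ugraph. simple_graph H \<and> verts H \<subseteq> {..<N}}
      \<subseteq> ?g ` (Pow {..<N} \<times> Pow (Pow {..<N}))"
  proof
    fix H :: "nat ugraph" assume "H \<in> {H. simple_graph H \<and> verts H \<subseteq> {..<N}}"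
    then have "verts H \<in> Pow {..<N}" "edges H \<in> Pow (Pow {..<N})"
      unfolding simple_graph_def by blast+
    moreover have "H = ?g (verts H, edges H)" by simp
    ultimately show "H \<in> ?g ` (Pow {..<N} \<times> Pow (Pow {..<N}))" by (metis SigmaI imageI)
  qed
qed simp

theorem theorem2:
  fixes r t :: nat and k :: int
  assumes "r \<ge> 3" and "t \<ge> r - 2"
  shows "\<exists>C :: nat ugraph set. finite C \<and> (\<forall>H\<in>C. simple_graph H) \<and>
    (\<forall>(G :: 'a ugraph) n. simple_graph G \<and> card (verts G) = n \<longrightarrow>
       (complete_saturated r G \<and> min_degree G \<ge> t \<and> int (card (edges G)) = int t * int n + k
        \<longleftrightarrow>
        (\<exists>H\<in>C. \<exists>S\<subseteq>verts H. pairwise_nonadjacent H S \<and> (\<forall>v\<in>S. degree H v = t) \<and>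
           obtained_by_blowing_up G H S)))"
proof (intro exI[of _ "{H. simple_graph H \<and> verts H \<subseteq> {..<core_bound t k} \<and> saturated_with r t k H}"]
    conjI allI impI)
  \<comment> \<open>The collection consists of all graphs on labels below
    \<open>core_bound t k\<close> that have the required properties themselves, with the same
    \<open>r\<close>, \<open>t\<close> and \<open>k\<close>.\<close>
  let ?C = "{H :: nat ugraph. simple_graph H \<and> verts H \<subseteq> {..<core_bound t k} \<and> saturated_with r t k H}"
  have r: "r \<ge> 2" using assms(1) by simp
  show "finite ?C" by (rule finite_subset[OF _ finite_bounded_graphs[of "core_bound t k"]]) auto
  show "\<forall>H\<in>?C. simple_graph H" by simp
  fix G :: "'a ugraph" and n
  assume "simple_graph G \<and> card (verts G) = n"
  then have G: "simple_graph G" and n: "n = card (verts G)" by auto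
  show "complete_saturated r G \<and> min_degree G \<ge> t \<and> int (card (edges G)) = int t * int n + k
    \<longleftrightarrow> (\<exists>H\<in>?C. \<exists>S\<subseteq>verts H. pairwise_nonadjacent H S \<and> (\<forall>v\<in>S. degree H v = t) \<and>
           obtained_by_blowing_up G H S)" (is "?P \<longleftrightarrow> ?Q")
  proof
    assume ?P
    then have "saturated_with r t k G" unfolding saturated_with_def n .
    then obtain H :: "nat ugraph" and S \<pi> where H: "simple_graph H" "verts H \<subseteq> {..<core_bound t k}"
      "saturated_with r t k H" "S \<subseteq> verts H" "pairwise_nonadjacent H S"
      "\<And>v. v \<in> S \<Longrightarrow> degree H v = t" "collapse G H S \<pi>"
      using bounded_core[OF G r, of t k] by blast
    then have "obtained_by_blowing_up G H S"
      using collapse_imp_obtained_by_blowing_up[OF simple_graph_finite[OF G]] by blast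
    then show ?Q using H(1-6) by blast
  next
    assume ?Q
    then obtain H :: "nat ugraph" and S where H: "simple_graph H" "saturated_with r t k H" "pairwise_nonadjacent H S"
      "\<And>v. v \<in> S \<Longrightarrow> degree H v = t" and ob: "obtained_by_blowing_up G H S"
      by blast
    obtain \<pi> where "collapse G H S \<pi>" using obtained_by_blowing_up_imp_collapse[OF ob] .
    then have "saturated_with r t k G"
      using saturated_with_blow_up[OF G H(1) _ H(3,4) r assms(2) H(2)] by blast
    then show ?P unfolding saturated_with_def n .
  qed
qed

end
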